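(* Let $I\subset R$ be a bihomogeneous ideal, let $(a,b)$ be an admissible bidegree for $I$, and let $h$ be an admissible linear form for $(a,b)$. For every $g'\in(R_{X,h})_0$ there are integers $\mu_\xi>0$, for $\xi\in\pi_b(V(I))$, such that the characteristic polynomial of $m_{g'}$ is $$\mathrm{CharPoly}_{m_{g'}}(\lambda)=\prod_{\xi\in\pi_b(V(I))}\big(\lambda-g'(\xi)\big)^{\mu_\xi}.$$
   Context: Let $k$ be a field with algebraic closure $\bar k$, $\mathbb{P}^n$ the projective space over $\bar k$, and $R=k[x_0,\dots,x_n,y_0,\dots,y_m]$ with the $\mathbb{Z}^2$-grading $\deg(x_i)=(1,0)$, $\deg(y_j)=(0,1)$; put $R_X=k[x_0,\dots,x_n]$ and $\mathfrak m_y=\langle y_0,\dots,y_m\rangle$. An ideal is bihomogeneous if it is generated by bihomogeneous elements. The subscript $a,b$ denotes the bidegree-$(a,b)$ component, and $\mathrm{HF}_{R/I}(a,b)=\dim_k(R/I)_{a,b}$. Admissible: a bidegree $(a,b)\in\mathbb{Z}_{\ge0}^2$ is admissible for $I$ if $I$ is generated in bidegrees componentwise $\le(a,b)$ and there is a polynomial $h$ of bidegree $(1,0)$ with $\mathrm{HF}_{R/I}(a,b)=\mathrm{HF}_{R/I}(a+1,b)$ and $\mathrm{HF}_{R/(I,h)}(a,b)=0$; such an $h$ is called an admissible linear form for $(a,b)$. $J_b:=(I:\mathfrak m_y^b)\cap R_X=\mathrm{Ann}_{R_X}\big(\bigoplus_{a'}(R/I)_{a',b}\big)$, and $\pi_b(V(I)):=V(J_b)\subset\mathbb{P}^n$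 is the (finite) vanishing set of $J_b$ over $\bar k$. An admissible linear form $h$ vanishes at no point of $\pi_b(V(I))$. $(R_{X,h})_0$ is the degree-zero part of the localization of $R_X$ at the powers of $h$. For $g\in R_{d,0}$, let $\bar m_g:(R/I)_{a,b}\to(R/I)_{a+d,b}$, $[f]\mapsto[gf]$; $\bar m_{h^d}$ is invertible for all $d\ge0$. For $g'=g/h^d\in(R_{X,h})_0$ with $g$ homogeneous of degree $d$, $m_{g'}:=\bar m_{h^d}^{-1}\circ\bar m_g$, an endomorphism of the $k$-vector space $(R/I)_{a,b}$ independent of the chosen representative, and $g'(\xi)=g(\xi)/h(\xi)^d\in\bar k$. The equality of polynomials is in $\bar k[\lambda]$. *)

theory Defs
  imports
    "HOL-Library.Poly_Mapping"
    "HOL-Algebra.Ideal_Product"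
    "HOL-Algebra.QuotRing"
    "HOL-Algebra.Algebraic_Closure_Type"
    "Jordan_Normal_Form.VS_Connect"
    "Jordan_Normal_Form.Char_Poly"
begin

text \<open>
  The variables \<open>x\<^sub>0, \<dots>, x\<^sub>n\<close> and \<open>y\<^sub>0, \<dots>, y\<^sub>m\<close> are indexed by two finite types \<open>'x\<close> and \<open>'y\<close>
  with \<open>n + 1\<close> and \<open>m + 1\<close> elements; types are nonempty, so \<open>n, m \<ge> 0\<close>. A polynomial maps power
  products to coefficients, \<open>Inl i\<close> being an \<open>x\<close>-variable and \<open>Inr j\<close> a \<open>y\<close>-variable, and
  \<^term>\<open>class_ring\<close> at this type is the ring \<open>R\<close>.
\<close>

type_synonym ('x, 'y, 'k) bipoly = "('x + 'y \<Rightarrow>\<^sub>0 nat) \<Rightarrow>\<^sub>0 'k"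

definition var :: "'x + 'y \<Rightarrow> ('x, 'y, 'k::field) bipoly" where
  "var v = Poly_Mapping.single (Poly_Mapping.single v 1) 1"

definition const_poly :: "'k \<Rightarrow> ('x, 'y, 'k::field) bipoly" where
  "const_poly c = Poly_Mapping.single 0 c"

definition xdeg :: "('x::finite + 'y::finite \<Rightarrow>\<^sub>0 nat) \<Rightarrow> nat" where
  "xdeg t = (\<Sum>i\<in>UNIV. Poly_Mapping.lookup t (Inl i))"

definition ydeg :: "('x::finite + 'y::finite \<Rightarrow>\<^sub>0 nat) \<Rightarrow> nat" where
  "ydeg t = (\<Sum>j\<in>UNIV. Poly_Mapping.lookup t (Inr j))"

text \<open>The component \<open>R\<^bsub>a,b\<^esub>\<close>; it contains the zero polynomial.\<close>

definition bihom :: "nat \<Rightarrow> nat \<Rightarrow> ('x::finite, 'y::finite, 'k::field) bipoly set" where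
  "bihom a b = {f. \<forall>t\<in>Poly_Mapping.keys f. xdeg t = a \<and> ydeg t = b}"

definition RX :: "('x::finite, 'y::finite, 'k::field) bipoly set" where
  "RX = {f. \<forall>t\<in>Poly_Mapping.keys f. \<forall>j. Poly_Mapping.lookup t (Inr j) = 0}"


definition bihomogeneous_ideal :: "('x::finite, 'y::finite, 'k::field) bipoly set \<Rightarrow> bool" where
  "bihomogeneous_ideal I \<longleftrightarrow>
     (\<exists>S. (\<forall>f\<in>S. \<exists>a b. f \<in> bihom a b) \<and> I = genideal class_ring S)"

definition generated_upto ::
    "('x::finite, 'y::finite, 'k::field) bipoly set \<Rightarrow> nat \<Rightarrow> nat \<Rightarrow> bool" where
  "generated_upto I a b \<longleftrightarrow>
     (\<exists>S. (\<forall>f\<in>S. \<exists>a' b'. a' \<le> a \<and> b' \<le> b \<and> f \<in> bihom a' b') \<and> I = genideal class_ring S)"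

text \<open>The class of \<open>f\<close> in \<open>R/I\<close>, and the \<open>k\<close>-vector space \<open>(R/I)\<^bsub>a,b\<^esub>\<close>. The fields \<open>mult\<close> and
  \<open>one\<close> are forced by the record type and play no role.\<close>

definition residue_class ::
    "('x, 'y, 'k::field) bipoly set \<Rightarrow> ('x, 'y, 'k) bipoly \<Rightarrow> ('x, 'y, 'k) bipoly set" where
  "residue_class I f = I +>\<^bsub>class_ring\<^esub> f"

definition quot_mult :: "('x, 'y, 'k::field) bipoly set \<Rightarrow> ('x, 'y, 'k) bipoly \<Rightarrow>
    ('x, 'y, 'k) bipoly set \<Rightarrow> ('x, 'y, 'k) bipoly set" where
  "quot_mult I g A = residue_class I g \<otimes>\<^bsub>class_ring Quot I\<^esub> A"

definition quot_comp :: "('x::finite, 'y::finite, 'k::field) bipoly set \<Rightarrow> nat \<Rightarrow> nat \<Rightarrow>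
    ('k, ('x, 'y, 'k) bipoly set) module" where
  "quot_comp I a b =
     \<lparr> carrier = residue_class I ` bihom a b,
       monoid.mult = monoid.mult (class_ring Quot I), monoid.one = monoid.one (class_ring Quot I),
       ring.zero = ring.zero (class_ring Quot I), ring.add = ring.add (class_ring Quot I),
       module.smult = (\<lambda>c. quot_mult I (const_poly c)) \<rparr>"

lemma bihom_add: "f \<in> bihom a b \<Longrightarrow> g \<in> bihom a b \<Longrightarrow> f + g \<in> bihom a b"
  using Poly_Mapping.keys_add[of f g] unfolding bihom_def by blast

lemma bihom_uminus: "f \<in> bihom a b \<Longrightarrow> - f \<in> bihom a b"
  unfolding bihom_def by (simp add: keys_def)

lemma bihom_const: "f \<in> bihom a b \<Longrightarrow> const_poly c * f \<in> bihom a b"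
  using Poly_Mapping.keys_mult[of "const_poly c" f] unfolding bihom_def const_poly_def
  by (auto split: if_splits)

lemma vectorspace_quot_comp:
  fixes I :: "('x::finite, 'y::finite, 'k::field) bipoly set"
  assumes "ideal I (class_ring :: ('x, 'y, 'k::field) bipoly ring)"
  shows "vectorspace (class_ring :: 'k ring) (quot_comp I a b)"
proof -
  let ?R = "class_ring :: ('x, 'y, 'k::field) bipoly ring"
  interpret ideal I ?R by fact
  interpret Q: ring "?R Quot I" by (rule quotient_is_ring)
  interpret h: ring_hom_ring ?R "?R Quot I" "residue_class I"
    using rcos_ring_hom_ring unfolding residue_class_def[abs_def] .
  have add: "residue_class I f \<oplus>\<^bsub>?R Quot I\<^esub> residue_class I g = residue_class I (f + g)" for f g
    using h.hom_add[of f g] by simp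
  have mul: "residue_class I f \<otimes>\<^bsub>?R Quot I\<^esub> residue_class I g = residue_class I (f * g)" for f g
    using h.hom_mult[of f g] by simp
  have z: "\<zero>\<^bsub>?R Quot I\<^esub> = residue_class I 0" using h.hom_zero by simp
  have c1: "const_poly (x+y) = const_poly x + const_poly y" "const_poly (x*y) = const_poly x * const_poly y" "const_poly 1 = 1" for x y :: 'k
    by (auto simp: const_poly_def single_add mult_single)
  have z0: "(0::('x,'y,'k) bipoly) \<in> bihom a b" by (simp add: bihom_def)
  have "abelian_group (quot_comp I a b)"
  proof (rule abelian_groupI)
    fix x assume "x \<in> carrier (quot_comp I a b)"
    then obtain f where "f \<in> bihom a b" "x = residue_class I f" by (auto simp: quot_comp_def)
    then show "\<exists>y\<in>carrier (quot_comp I a b). y \<oplus>\<^bsub>quot_comp I a b\<^esub> x = \<zero>\<^bsub>quot_comp I a b\<^esub>"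
      using bihom_uminus[of f a b] by (auto intro!: bexI[of _ "-f"] simp: quot_comp_def add z)
  qed (simp_all add: quot_comp_def, (auto simp: add z z0 ac_simps intro!: bihom_add imageI)[5])
  moreover have "field (class_ring :: 'k ring)" by (rule class_field)
  ultimately show ?thesis
    unfolding vectorspace_def module_def module_axioms_def
    by (auto simp: quot_comp_def quot_mult_def add mul c1 algebra_simps field_def domain_def intro!: imageI bihom_const bihom_const[unfolded mult.commute[of "const_poly c" for c]])
qed

definition HF :: "('x::finite, 'y::finite, 'k::field) bipoly set \<Rightarrow> nat \<Rightarrow> nat \<Rightarrow> nat" where
  "HF I a b = vectorspace.dim (class_ring :: 'k ring) (quot_comp I a b)"

definition admissible_form :: "('x::finite, 'y::finite, 'k::field) bipoly set \<Rightarrow>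
    nat \<Rightarrow> nat \<Rightarrow> ('x, 'y, 'k) bipoly \<Rightarrow> bool" where
  "admissible_form I a b h \<longleftrightarrow>
     h \<in> bihom 1 0 \<and> HF I a b = HF I (a + 1) b \<and>
     HF (genideal class_ring (insert h I)) a b = 0"

definition admissible :: "('x::finite, 'y::finite, 'k::field) bipoly set \<Rightarrow> nat \<Rightarrow> nat \<Rightarrow> bool" where
  "admissible I a b \<longleftrightarrow> generated_upto I a b \<and> (\<exists>h. admissible_form I a b h)"


definition colon :: "('x, 'y, 'k::field) bipoly set \<Rightarrow> ('x, 'y, 'k) bipoly set \<Rightarrow>
    ('x, 'y, 'k) bipoly set" where
  "colon I J = {f. \<forall>g\<in>J. f * g \<in> I}"

definition ideal_y :: "('x, 'y, 'k::field) bipoly set" where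
  "ideal_y = genideal class_ring ((\<lambda>j. var (Inr j)) ` UNIV)"

definition J_ideal :: "('x::finite, 'y::finite, 'k::field) bipoly set \<Rightarrow> nat \<Rightarrow>
    ('x, 'y, 'k) bipoly set" where
  "J_ideal I b = colon I (ideal_y [^]\<^bsub>ideals_set class_ring\<^esub> b) \<inter> RX"

text \<open>The projective space over the algebraic closure. A point is the set of all its vectors of
  homogeneous coordinates.\<close>

type_synonym ('x, 'k) proj_point = "('x \<Rightarrow> 'k alg_closure) set"

definition proj_space :: "('x, 'k::field) proj_point set" where
  "proj_space = {v. v \<noteq> (\<lambda>_. 0)} //
     {(v, w). v \<noteq> (\<lambda>_. 0) \<and> (\<exists>c. c \<noteq> 0 \<and> w = (\<lambda>i. c * v i))}"

text \<open>The value at \<open>v\<close> of a polynomial in \<^term>\<open>RX\<close>, in which no \<open>y\<close>-variable occurs.\<close>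

definition evalX :: "('x::finite \<Rightarrow> 'k alg_closure) \<Rightarrow> ('x, 'y, 'k::field) bipoly \<Rightarrow>
    'k alg_closure" where
  "evalX v f = (\<Sum>t\<in>Poly_Mapping.keys f. to_ac (Poly_Mapping.lookup f t) * (\<Prod>i\<in>UNIV. v i ^ Poly_Mapping.lookup t (Inl i)))"

definition vanishing_set :: "('x::finite, 'y, 'k::field) bipoly set \<Rightarrow> ('x, 'k) proj_point set" where
  "vanishing_set K = {\<xi> \<in> proj_space. \<forall>v\<in>\<xi>. \<forall>f\<in>K. evalX v f = 0}"

definition proj_pts :: "('x::finite, 'y::finite, 'k::field) bipoly set \<Rightarrow> nat \<Rightarrow>
    ('x, 'k) proj_point set" where
  "proj_pts I b = vanishing_set (J_ideal I b)"


text \<open>The fraction \<open>g/h\<^sup>d\<close> as an element of the localization of \<^term>\<open>RX\<close> at the powers of \<open>h\<close>, i.e. as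
  the equivalence class of the pair \<open>(g, d)\<close>, and the degree-zero part of this localization.\<close>

definition fraction :: "('x::finite, 'y::finite, 'k::field) bipoly \<Rightarrow> ('x, 'y, 'k) bipoly \<Rightarrow> nat \<Rightarrow>
    (('x, 'y, 'k) bipoly \<times> nat) set" where
  "fraction h g d = {(g', d'). g' \<in> RX \<and> (\<exists>e. h ^ e * (h ^ d' * g - h ^ d * g') = 0)}"

definition localization0 :: "('x::finite, 'y::finite, 'k::field) bipoly \<Rightarrow>
    (('x, 'y, 'k) bipoly \<times> nat) set set" where
  "localization0 h = {fraction h g d | g d. g \<in> bihom d 0}"

definition fraction_rep :: "('x::finite, 'y::finite, 'k::field) bipoly \<Rightarrow>
    (('x, 'y, 'k) bipoly \<times> nat) set \<Rightarrow> ('x, 'y, 'k) bipoly \<times> nat" where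
  "fraction_rep h q = (SOME (g, d). g \<in> bihom d 0 \<and> q = fraction h g d)"

text \<open>The endomorphism \<open>m\<^bsub>g/h^d\<^esub>\<close> of \<open>(R/I)\<^bsub>a,b\<^esub>\<close> and the value of \<open>g/h\<^sup>d\<close> at a point. If \<open>h\<close> is
  admissible for \<open>(a, b)\<close> and the point lies in \<^term>\<open>proj_pts I b\<close>, neither depends on the choices
  of a representative of the fraction and of homogeneous coordinates.\<close>

definition mult_map :: "('x::finite, 'y::finite, 'k::field) bipoly set \<Rightarrow> nat \<Rightarrow> nat \<Rightarrow>
    ('x, 'y, 'k) bipoly \<Rightarrow> (('x, 'y, 'k) bipoly \<times> nat) set \<Rightarrow>
    ('x, 'y, 'k) bipoly set \<Rightarrow> ('x, 'y, 'k) bipoly set" where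
  "mult_map I a b h q =
     (case fraction_rep h q of (g, d) \<Rightarrow>
        inv_into (carrier (quot_comp I a b)) (quot_mult I (h ^ d)) \<circ> quot_mult I g)"

definition frac_eval :: "('x::finite, 'y::finite, 'k::field) bipoly \<Rightarrow>
    (('x, 'y, 'k) bipoly \<times> nat) set \<Rightarrow> ('x, 'k) proj_point \<Rightarrow> 'k alg_closure" where
  "frac_eval h q \<xi> =
     (case fraction_rep h q of (g, d) \<Rightarrow> let v = (SOME v. v \<in> \<xi>) in evalX v g / evalX v h ^ d)"


text \<open>The characteristic polynomial of an endomorphism of a finite-dimensional vector space is that
  of its matrix with respect to an arbitrary ordered basis.\<close>

definition represents :: "('k::field, 'v, 'c) module_scheme \<Rightarrow> 'v list \<Rightarrow> ('v \<Rightarrow> 'v) \<Rightarrow>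
    'k mat \<Rightarrow> bool" where
  "represents V bs T M \<longleftrightarrow>
     M \<in> carrier_mat (length bs) (length bs) \<and>
     (\<forall>j<length bs. T (bs ! j) = (\<Oplus>\<^bsub>V\<^esub>i\<in>{..<length bs}. M $$ (i, j) \<odot>\<^bsub>V\<^esub> bs ! i))"

definition char_poly_endo :: "('k::field, 'v, 'c) module_scheme \<Rightarrow> ('v \<Rightarrow> 'v) \<Rightarrow> 'k poly" where
  "char_poly_endo V T =
     char_poly (SOME M. \<exists>bs. distinct bs \<and> vectorspace.basis class_ring V (set bs) \<and>
                             represents V bs T M)"

end

theory Submission
  imports Defs
begin

text \<open>
  Write \<open>V = (R/I)\<^bsub>a,b\<^esub>\<close> and \<open>N = dim V\<close>, and let \<open>K\<close> be the algebraic closure of \<open>k\<close>.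

  \<^emph>\<open>Division by \<open>h\<close>.\<close> Since \<open>(I, h)\<close> contains \<open>R\<^bsub>a,b\<^esub>\<close>, every element of \<open>R\<^bsub>a,b\<^esub>\<close> is a multiple of \<open>h\<close>
  modulo \<open>I\<close>. Multiplying by monomials in the \<open>x\<close>-variables carries this to all higher \<open>x\<close>-degrees, so
  \<open>h : (R/I)\<^bsub>a+d,b\<^esub> \<rightarrow> (R/I)\<^bsub>a+d+1,b\<^esub>\<close> is surjective for all \<open>d\<close>; for \<open>d = 0\<close> the dimensions agree and it
  is bijective. Let \<open>red : R\<^bsub>a+1,b\<^esub> \<rightarrow> V\<close> be the resulting division by \<open>h\<close>. The endomorphisms
  \<open>w \<mapsto> red (x\<^sub>i w)\<close> of \<open>V\<close> commute: write \<open>w = h w'\<close> modulo \<open>I\<close>; then both composites send \<open>w\<close> to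
  \<open>red (x\<^sub>i x\<^sub>j w')\<close>. Hence splitting off one variable at a time and reducing gives linear maps
  \<open>nf : R\<^bsub>a+d,b\<^esub> \<rightarrow> V\<close> that do not depend on the order of the variables. They vanish on \<open>I\<close>, because \<open>I\<close>
  is generated in bidegrees at most \<open>(a, b)\<close>, and they invert \<open>h\<^sup>d\<close>. So \<open>h\<^sup>d\<close> is bijective on \<open>V\<close>
  (\<open>h_power_injective\<close>, \<open>h_power_surjective\<close>).

  \<^emph>\<open>Joint eigenvalues.\<close> A form \<open>F\<close> of bidegree \<open>(d, 0)\<close> now has a matrix over \<open>k\<close>, that of \<open>h\<^bsup>-d\<^esup> F\<close>
  on \<open>V\<close>, and this assignment is additive and multiplicative, with \<open>h\<close> going to the identity. The
  matrices of the variables commute, so they become upper triangular in a common basis over \<open>K\<close>. Let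
  \<open>p\<^sub>j \<in> K\<^bsup>n+1\<^esup>\<close> consist of their \<open>j\<close>-th diagonal entries. Then the matrix of every \<open>F\<close> is upper
  triangular in that basis with diagonal \<open>F(p\<^sub>j)\<close>, and its characteristic polynomial is
  \<open>\<Prod>\<^sub>j (\<lambda> - F(p\<^sub>j))\<close> (\<open>char_poly_mult_mat\<close>). In particular \<open>h(p\<^sub>j) = 1\<close>.

  \<^emph>\<open>The points.\<close> It remains to see that the classes of \<open>p\<^sub>0, \<dots>, p\<^bsub>N-1\<^esub>\<close> are exactly the points of
  \<open>\<pi>\<^sub>b(V(I)) = V(J\<^sub>b)\<close>; the multiplicity of a point is then the number of \<open>j\<close> that give it.
  A form in \<open>J\<^sub>b\<close> has matrix \<open>0\<close>, so it vanishes at all \<open>p\<^sub>j\<close>. Conversely let \<open>v \<noteq> 0\<close> be a zero of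
  \<open>J\<^sub>b\<close>. A form \<open>F\<close> with matrix \<open>0\<close> satisfies \<open>x\<^sub>i\<^sup>a F \<in> J\<^sub>b\<close> for all \<open>i\<close>, so \<open>F(v) = 0\<close>. Therefore, in
  each degree, \<open>F(v)\<close> is a linear function of the matrix of \<open>F\<close>, and the same function computes the
  value at \<open>v\<close> of a \<open>K\<close>-linear combination of forms from the corresponding combination of matrices.
  For any choice of indices \<open>i\<^sub>j\<close> the product over \<open>j < N\<close> of the forms \<open>x\<^bsub>i\<^sub>j\<^esub> - (p\<^sub>j)\<^bsub>i\<^sub>j\<^esub> h\<close> has matrix
  \<open>0\<close>, being a product of \<open>N\<close> upper triangular matrices whose \<open>j\<close>-th factor has a zero in the \<open>j\<close>-th
  diagonal place. So \<open>\<Prod>\<^sub>j (v\<^bsub>i\<^sub>j\<^esub> - (p\<^sub>j)\<^bsub>i\<^sub>j\<^esub> h(v)) = 0\<close> for all choices, which forces \<open>v = h(v) p\<^sub>j\<close> for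
  some \<open>j\<close> (\<open>proj_pts_point\<close>). This also shows \<open>h(v) \<noteq> 0\<close>.
\<close>

\<comment> \<open>The symbol is shared with vector indexing, which is meant throughout.\<close>
no_notation fps_nth (infixl \<open>$\<close> 75)

section \<open>Simultaneous triangularization of commuting matrices\<close>

text \<open>The vector \<open>p(A) w\<close>, computed by the Horner scheme.\<close>

definition poly_action :: "'a::field mat \<Rightarrow> 'a vec \<Rightarrow> 'a poly \<Rightarrow> 'a vec" where
  "poly_action A w p = fold_coeffs (\<lambda>c u. c \<cdot>\<^sub>v w + A *\<^sub>v u) p (0\<^sub>v (dim_vec w))"

context
  fixes A :: "'a::field mat" and w :: "'a vec" and n :: nat
  assumes A: "A \<in> carrier_mat n n" and w: "w \<in> carrier_vec n"
begin

lemma poly_action_0 [simp]: "poly_action A w 0 = 0\<^sub>v n"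
  using w by (simp add: poly_action_def)

lemma poly_action_pCons: "poly_action A w (pCons c p) = c \<cdot>\<^sub>v w + A *\<^sub>v poly_action A w p"
proof (cases "c = 0 \<and> p = 0")
  case True
  then show ?thesis using A w by (auto simp: poly_action_def)
next
  case False
  then show ?thesis by (auto simp: poly_action_def)
qed

lemma poly_action_carrier [simp]: "poly_action A w p \<in> carrier_vec n"
  by (induction p) (use A w in \<open>auto simp: poly_action_pCons\<close>)

lemma dim_poly_action [simp]: "dim_vec (poly_action A w p) = n"
  using poly_action_carrier[of p] by (rule carrier_vecD)

lemma poly_action_add: "poly_action A w (p + q) = poly_action A w p + poly_action A w q"
proof (induction p arbitrary: q)
  case (pCons c p)
  obtain d r where q: "q = pCons d r" by (cases q)
  have "A *\<^sub>v (poly_action A w p + poly_action A w r)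
      = A *\<^sub>v poly_action A w p + A *\<^sub>v poly_action A w r"
    by (rule mult_add_distrib_mat_vec[OF A]) auto
  then show ?case using A w
    by (auto simp: q poly_action_pCons pCons.IH add_smult_distrib_vec intro!: eq_vecI)
qed auto

lemma poly_action_smult: "poly_action A w (Polynomial.smult c p) = c \<cdot>\<^sub>v poly_action A w p"
proof (induction p)
  case (pCons d p)
  have "A *\<^sub>v (c \<cdot>\<^sub>v poly_action A w p) = c \<cdot>\<^sub>v (A *\<^sub>v poly_action A w p)"
    by (rule mult_mat_vec[OF A]) auto
  then show ?case using A w
    by (auto simp: poly_action_pCons pCons.IH algebra_simps intro!: eq_vecI)
qed auto

lemma poly_action_linear_factor:
  "poly_action A w ([:- c, 1:] * p) = A *\<^sub>v poly_action A w p - c \<cdot>\<^sub>v poly_action A w p"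
proof -
  have "[:- c, 1:] * p = Polynomial.smult (- c) p + pCons 0 p"
    by simp
  then have "poly_action A w ([:- c, 1:] * p) = poly_action A w (Polynomial.smult (- c) p + pCons 0 p)"
    by (rule arg_cong)
  also have "\<dots> = A *\<^sub>v poly_action A w p - c \<cdot>\<^sub>v poly_action A w p"
    unfolding poly_action_add poly_action_smult poly_action_pCons
    using A w by (intro eq_vecI) auto
  finally show ?thesis .
qed

text \<open>This is what makes one common eigenvector out of many: passing from \<open>w\<close> to \<open>p(A) w\<close> loses no
  eigenvector equation of a matrix commuting with \<open>A\<close>.\<close>

lemma poly_action_commuting_eigenvector:
  assumes B: "B \<in> carrier_mat n n" and AB: "A * B = B * A" and ev: "B *\<^sub>v w = b \<cdot>\<^sub>v w"
  shows "B *\<^sub>v poly_action A w p = b \<cdot>\<^sub>v poly_action A w p"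
proof (induction p)
  case (pCons c p)
  let ?u = "poly_action A w p"
  have "B *\<^sub>v (A *\<^sub>v ?u) = A *\<^sub>v (B *\<^sub>v ?u)"
    using assoc_mult_mat_vec[OF A B, of ?u] assoc_mult_mat_vec[OF B A, of ?u] AB by simp
  also have "\<dots> = b \<cdot>\<^sub>v (A *\<^sub>v ?u)"
    unfolding pCons.IH by (rule mult_mat_vec[OF A]) auto
  finally have 1: "B *\<^sub>v (A *\<^sub>v ?u) = b \<cdot>\<^sub>v (A *\<^sub>v ?u)" .
  have 2: "B *\<^sub>v (c \<cdot>\<^sub>v w) = b \<cdot>\<^sub>v (c \<cdot>\<^sub>v w)"
    using mult_mat_vec[OF B w, of c] ev by (simp add: smult_smult_assoc mult.commute)
  have "B *\<^sub>v (c \<cdot>\<^sub>v w + A *\<^sub>v ?u) = B *\<^sub>v (c \<cdot>\<^sub>v w) + B *\<^sub>v (A *\<^sub>v ?u)"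
    by (rule mult_add_distrib_mat_vec[OF B]) (use A w in auto)
  also have "\<dots> = b \<cdot>\<^sub>v (c \<cdot>\<^sub>v w + A *\<^sub>v ?u)"
    unfolding 1 2 by (rule smult_add_distrib_vec[symmetric, of _ n]) (use A w in auto)
  finally show ?case by (simp add: poly_action_pCons)
qed (use B in auto)

lemma poly_action_sum_monom:
  assumes "\<And>i. i < n \<Longrightarrow> row R i = vec (Suc m) (\<lambda>j. poly_action A w (monom 1 j) $ i)"
    and c: "c \<in> carrier_vec (Suc m)" and i: "i < n"
  shows "poly_action A w (\<Sum>j<Suc m. monom (c $ j) j) $ i = row R i \<bullet> c"
proof -
  have mon: "poly_action A w (monom x j) = x \<cdot>\<^sub>v poly_action A w (monom 1 j)" for x j
    by (simp add: poly_action_smult[symmetric] smult_monom)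
  have "poly_action A w (\<Sum>j<k. monom (c $ j) j) $ i = (\<Sum>j<k. c $ j * poly_action A w (monom 1 j) $ i)" for k
  proof (induction k)
    case (Suc k)
    have "c $ k \<cdot>\<^sub>v poly_action A w (monom 1 k) = poly_action A w (monom (c $ k) k)"
      using mon[of "c $ k" k] ..
    moreover have "poly_action A w (monom (c $ k) k) $ i = c $ k * poly_action A w (monom 1 k) $ i"
      unfolding mon[of "c $ k" k] using i by simp
    ultimately show ?case using i Suc by (simp add: poly_action_add)
  qed (use i in simp)
  also have "(\<Sum>j<Suc m. c $ j * poly_action A w (monom 1 j) $ i) = row R i \<bullet> c"
    using c by (simp add: assms(1)[OF i] scalar_prod_def lessThan_atLeast0 mult.commute)
  finally show ?thesis .
qed

text \<open>The \<open>n + 1\<close> vectors \<open>w, A w, \<dots>, A\<^sup>n w\<close> are linearly dependent. The dependence is read off from a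
  kernel vector of the square matrix that has them as columns, padded by a zero row.\<close>

lemma annihilating_poly_exists: "\<exists>p. p \<noteq> 0 \<and> poly_action A w p = 0\<^sub>v n"
proof -
  define R where "R = Matrix.mat (Suc n) (Suc n)
    (\<lambda>(i, j). if i < n then poly_action A w (monom 1 j) $ i else 0)"
  have R: "R \<in> carrier_mat (Suc n) (Suc n)" by (simp add: R_def)
  have "det R = 0"
    by (subst laplace_expansion_row[OF R, of n]) (auto simp: R_def)
  then obtain c where c: "c \<in> carrier_vec (Suc n)" "c \<noteq> 0\<^sub>v (Suc n)" "R *\<^sub>v c = 0\<^sub>v (Suc n)"
    using det_0_iff_vec_prod_zero[OF R] by blast
  define p where "p = (\<Sum>j<Suc n. monom (c $ j) j)"
  have "coeff p j = c $ j" if "j < Suc n" for j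
    using that by (simp add: p_def coeff_sum coeff_monom sum.delta' del: sum.lessThan_Suc)
  moreover have "\<exists>j<Suc n. c $ j \<noteq> 0"
    using c(1,2) by (metis carrier_vecD eq_vecI index_zero_vec(1) index_zero_vec(2))
  ultimately have "p \<noteq> 0" by auto
  moreover have "poly_action A w p = 0\<^sub>v n"
  proof (rule eq_vecI)
    fix i assume "i < dim_vec (0\<^sub>v n :: 'a vec)"
    then have i: "i < n" by simp
    have "poly_action A w p $ i = row R i \<bullet> c"
      unfolding p_def using c(1) i by (intro poly_action_sum_monom) (auto simp: R_def)
    also have "\<dots> = (R *\<^sub>v c) $ i" using i R by simp
    finally show "poly_action A w p $ i = 0\<^sub>v n $ i" using c(3) i by simp
  qed (use poly_action_carrier[of p] in auto)
  ultimately show ?thesis by blast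
qed

end

text \<open>If \<open>p\<close> has minimal degree among the nonzero polynomials with \<open>p(A) w = 0\<close> and \<open>c\<close> is a root of
  \<open>p = (X - c) q\<close>, then \<open>q(A) w\<close> is nonzero and is killed by \<open>A - c\<close>.\<close>

lemma eigenvector_in_cyclic_subspace:
  fixes A :: "'a::alg_closed_field mat"
  assumes A: "A \<in> carrier_mat n n" and w: "w \<in> carrier_vec n" "w \<noteq> 0\<^sub>v n"
  obtains p c where "poly_action A w p \<noteq> 0\<^sub>v n"
    "A *\<^sub>v poly_action A w p = c \<cdot>\<^sub>v poly_action A w p"
proof -
  let ?P = "\<lambda>p. p \<noteq> 0 \<and> poly_action A w p = 0\<^sub>v n"
  obtain p where p: "?P p" and min: "\<And>q. ?P q \<Longrightarrow> Polynomial.degree p \<le> Polynomial.degree q"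
    using annihilating_poly_exists[OF A w(1)] ex_has_least_nat[of ?P _ Polynomial.degree] by metis
  have "Polynomial.degree p \<noteq> 0"
  proof
    assume "Polynomial.degree p = 0"
    then obtain d where d: "p = [:d:]" by (rule degree_eq_zeroE)
    have "A *\<^sub>v 0\<^sub>v n = 0\<^sub>v n" using A by auto
    then have "d \<cdot>\<^sub>v w = 0\<^sub>v n"
      using p A w smult_carrier_vec[of d w n]
      by (auto simp: d poly_action_pCons[OF A w(1)] poly_action_0[OF A w(1)])
    moreover have "d \<noteq> 0" using p d by auto
    ultimately have "w = 0\<^sub>v n" using w(1)
      by (metis eq_vecI index_smult_vec(1) index_zero_vec mult_eq_0_iff carrier_vecD)
    with w(2) show False ..
  qed
  then obtain c where "poly p c = 0" using alg_closed_imp_poly_has_root by blast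
  then obtain q where q: "p = [:- c, 1:] * q" by (auto simp: poly_eq_0_iff_dvd)
  let ?u = "poly_action A w q"
  have "q \<noteq> 0" using p q by auto
  then have "Polynomial.degree p = Suc (Polynomial.degree q)"
    unfolding q by (subst degree_mult_eq) auto
  then have u: "?u \<noteq> 0\<^sub>v n" using min[of q] \<open>q \<noteq> 0\<close> by auto
  have dim: "?u \<in> carrier_vec n" using poly_action_carrier[OF A w(1)] .
  have "A *\<^sub>v ?u - c \<cdot>\<^sub>v ?u = 0\<^sub>v n"
    using p unfolding q by (simp only: poly_action_linear_factor[OF A w(1)])
  then have "A *\<^sub>v ?u = c \<cdot>\<^sub>v ?u"
    using A dim by (intro eq_vecI) (auto simp: vec_eq_iff)
  with u show ?thesis by (rule that)
qed

lemma common_eigenvector: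
  fixes A :: "'i \<Rightarrow> 'a::alg_closed_field mat"
  assumes "finite S" and n: "n > 0" and A: "\<And>i. i \<in> S \<Longrightarrow> A i \<in> carrier_mat n n"
    and comm: "\<And>i j. i \<in> S \<Longrightarrow> j \<in> S \<Longrightarrow> A i * A j = A j * A i"
  shows "\<exists>w\<in>carrier_vec n. w \<noteq> 0\<^sub>v n \<and> (\<forall>i\<in>S. \<exists>c. A i *\<^sub>v w = c \<cdot>\<^sub>v w)"
  using assms(1,3,4)
proof (induction S rule: finite_induct)
  case empty
  have "unit_vec n 0 \<noteq> (0\<^sub>v n :: 'a vec)" using n by (auto simp: vec_eq_iff unit_vec_def)
  then show ?case by (intro bexI[of _ "unit_vec n 0"]) auto
next
  case (insert k S)
  then obtain w where w: "w \<in> carrier_vec n" "w \<noteq> 0\<^sub>v n"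
    and ev: "\<And>i. i \<in> S \<Longrightarrow> \<exists>c. A i *\<^sub>v w = c \<cdot>\<^sub>v w" by auto
  have k: "A k \<in> carrier_mat n n" using insert.prems by simp
  obtain p c where p: "poly_action (A k) w p \<noteq> 0\<^sub>v n"
    "A k *\<^sub>v poly_action (A k) w p = c \<cdot>\<^sub>v poly_action (A k) w p"
    by (rule eigenvector_in_cyclic_subspace[OF k w])
  have "\<exists>c. A i *\<^sub>v poly_action (A k) w p = c \<cdot>\<^sub>v poly_action (A k) w p" if "i \<in> S" for i
    using poly_action_commuting_eigenvector[OF k w(1), of "A i"] insert.prems that ev[OF that] by blast
  with p show ?case
    by (intro bexI[of _ "poly_action (A k) w p"]) (auto simp: poly_action_carrier[OF k w(1)])
qed

text \<open>Exchange coordinates so that \<open>w\<close> has a nonzero entry in place \<open>0\<close>, and then replace the first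
  column of the identity matrix by \<open>w\<close>: the result is lower triangular with nonzero diagonal.\<close>

lemma invertible_with_first_column:
  fixes w :: "'a::field vec"
  assumes w: "w \<in> carrier_vec n" "w \<noteq> 0\<^sub>v n"
  obtains P Q where "P \<in> carrier_mat n n" "Q \<in> carrier_mat n n" "P * Q = 1\<^sub>m n" "Q * P = 1\<^sub>m n"
    "col Q 0 = w"
proof -
  obtain k where k: "k < n" "w $ k \<noteq> 0"
    using w by (metis carrier_vecD eq_vecI index_zero_vec)
  define f where "f i = (if i = 0 then k else if i = k then 0 else i)" for i :: nat
  define L where "L = Matrix.mat n n (\<lambda>(i, j). if j = 0 then w $ f i else if i = j then 1 else 0)"
  define Q where "Q = swaprows 0 k L"
  have L: "L \<in> carrier_mat n n" by (simp add: L_def)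
  then have Q: "Q \<in> carrier_mat n n" by (simp add: Q_def)
  have "det L = prod_list (diag_mat L)"
    by (rule det_lower_triangular[OF _ L]) (auto simp: L_def)
  then have "det L \<noteq> 0" using k by (auto simp: diag_mat_def L_def f_def prod_list_zero_iff)
  have "det Q \<noteq> 0"
  proof (cases "k = 0")
    case True
    then have "Q = L" unfolding Q_def using L by (intro eq_matI) auto
    with \<open>det L \<noteq> 0\<close> show ?thesis by simp
  next
    case False
    then show ?thesis using \<open>det L \<noteq> 0\<close> k by (simp add: Q_def det_swaprows[OF _ _ _ L])
  qed
  then have "Q \<in> Units (ring_mat TYPE('a) n ())" by (rule det_non_zero_imp_unit[OF Q])
  then obtain P where P: "P \<in> carrier_mat n n" "P * Q = 1\<^sub>m n" "Q * P = 1\<^sub>m n"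
    by (auto simp: Units_def ring_mat_def)
  have "col Q 0 = w"
    using L k w by (intro eq_vecI) (auto simp: Q_def L_def f_def)
  with P Q show ?thesis using that by blast
qed

lemma first_column_reduction:
  fixes A :: "'a::field mat"
  assumes A: "A \<in> carrier_mat (Suc n) (Suc n)"
    and PQ: "P \<in> carrier_mat (Suc n) (Suc n)" "Q \<in> carrier_mat (Suc n) (Suc n)"
      "P * Q = 1\<^sub>m (Suc n)"
    and ev: "A *\<^sub>v col Q 0 = c \<cdot>\<^sub>v col Q 0"
  obtains b A' where "b \<in> carrier_mat 1 n" "A' \<in> carrier_mat n n"
    "P * A * Q = four_block_mat (Matrix.mat 1 1 (\<lambda>_. c)) b (0\<^sub>m n 1) A'"
proof -
  let ?B = "P * A * Q"
  have B: "?B \<in> carrier_mat (Suc n) (Suc n)" using A PQ by auto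
  have q: "col Q 0 \<in> carrier_vec (Suc n)" using PQ(2) by (intro col_carrier_vec) auto
  have c1: "col (P * Q) 0 = P *\<^sub>v col Q 0" by (rule col_mult2) (use PQ in auto)
  have "col ?B 0 = (P * A) *\<^sub>v col Q 0" by (rule col_mult2) (use A PQ in auto)
  also have "\<dots> = P *\<^sub>v (A *\<^sub>v col Q 0)" by (rule assoc_mult_mat_vec[OF PQ(1) A q])
  also have "\<dots> = c \<cdot>\<^sub>v (P *\<^sub>v col Q 0)" unfolding ev by (rule mult_mat_vec[OF PQ(1) q])
  also have "\<dots> = c \<cdot>\<^sub>v unit_vec (Suc n) 0" unfolding c1[symmetric] PQ(3) by simp
  finally have col: "col ?B 0 = c \<cdot>\<^sub>v unit_vec (Suc n) 0" .
  have col0: "?B $$ (i, 0) = (if i = 0 then c else 0)" if "i < Suc n" for i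
  proof -
    have "?B $$ (i, 0) = col ?B 0 $ i" using that B by (simp del: index_mult_mat)
    then show ?thesis using that unfolding col by (simp add: unit_vec_def)
  qed
  obtain B1 B2 B3 B4 where sp: "split_block ?B 1 1 = (B1, B2, B3, B4)"
    by (metis surj_pair)
  note blk = split_block[OF sp, of n n]
  have d: "dim_row ?B = 1 + n" "dim_col ?B = 1 + n" using B by auto
  note blk = blk[OF d]
  have "B1 = Matrix.mat 1 1 (\<lambda>_. c)"
    using sp col0[of 0] d by (auto simp: split_block_def Let_def simp del: index_mult_mat intro!: eq_matI)
  moreover have "B3 = 0\<^sub>m n 1"
    using sp col0 d by (auto simp: split_block_def Let_def simp del: index_mult_mat intro!: eq_matI)
  ultimately show ?thesis using that[OF blk(2,4)] blk(5) by simp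
qed

lemma conjugate_mult:
  fixes A B :: "'a::semiring_1 mat"
  assumes "A \<in> carrier_mat n n" "B \<in> carrier_mat n n" "P \<in> carrier_mat n n" "Q \<in> carrier_mat n n"
    "Q * P = 1\<^sub>m n"
  shows "(P * A * Q) * (P * B * Q) = P * (A * B) * Q"
proof -
  have "(P * A * Q) * (P * B * Q) = P * A * (Q * P) * B * Q"
    using assms(1-4) by (simp add: assoc_mult_mat[of _ n n _ n _ n])
  then show ?thesis using assms by (simp add: assoc_mult_mat[of _ n n _ n _ n])
qed

text \<open>Induction on the size: a common eigenvector, taken as the first basis vector, splits off a
  \<open>1 \<times> 1\<close> block, and the complementary blocks commute again.\<close>

lemma simultaneous_triangularization:
  fixes A :: "'i \<Rightarrow> 'a::alg_closed_field mat"
  assumes "finite S" and "\<And>i. i \<in> S \<Longrightarrow> A i \<in> carrier_mat n n"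
    and "\<And>i j. i \<in> S \<Longrightarrow> j \<in> S \<Longrightarrow> A i * A j = A j * A i"
  shows "\<exists>P Q. P \<in> carrier_mat n n \<and> Q \<in> carrier_mat n n \<and> P * Q = 1\<^sub>m n \<and> Q * P = 1\<^sub>m n \<and>
    (\<forall>i\<in>S. upper_triangular (P * A i * Q))"
  using assms(2,3)
proof (induction n arbitrary: A)
  case 0
  then show ?case by (intro exI[of _ "1\<^sub>m 0"]) auto
next
  case (Suc n)
  obtain w where w: "w \<in> carrier_vec (Suc n)" "w \<noteq> 0\<^sub>v (Suc n)"
    and "\<forall>i\<in>S. \<exists>c. A i *\<^sub>v w = c \<cdot>\<^sub>v w"
    using common_eigenvector[OF assms(1) zero_less_Suc, of A n] Suc.prems by auto
  then obtain c where c: "\<And>i. i \<in> S \<Longrightarrow> A i *\<^sub>v w = c i \<cdot>\<^sub>v w" by metis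
  obtain P Q where PQ: "P \<in> carrier_mat (Suc n) (Suc n)" "Q \<in> carrier_mat (Suc n) (Suc n)"
    "P * Q = 1\<^sub>m (Suc n)" "Q * P = 1\<^sub>m (Suc n)" and col: "col Q 0 = w"
    by (rule invertible_with_first_column[OF w])
  have "\<exists>b A'. b \<in> carrier_mat 1 n \<and> A' \<in> carrier_mat n n \<and>
    P * A i * Q = four_block_mat (Matrix.mat 1 1 (\<lambda>_. c i)) b (0\<^sub>m n 1) A'" if "i \<in> S" for i
    using first_column_reduction[OF Suc.prems(1)[OF that] PQ(1-3), of "c i"] c[OF that] col by metis
  then obtain b A' where b: "\<And>i. i \<in> S \<Longrightarrow> b i \<in> carrier_mat 1 n"
    and A': "\<And>i. i \<in> S \<Longrightarrow> A' i \<in> carrier_mat n n"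
    and block: "\<And>i. i \<in> S \<Longrightarrow>
      P * A i * Q = four_block_mat (Matrix.mat 1 1 (\<lambda>_. c i)) (b i) (0\<^sub>m n 1) (A' i)" by metis
  let ?c = "\<lambda>i. Matrix.mat 1 1 (\<lambda>_. c i)"
  have cc: "?c i \<in> carrier_mat 1 1" for i by simp
  have prod: "P * (A i * A j) * Q =
      four_block_mat (?c i * ?c j + b i * 0\<^sub>m n 1) (?c i * b j + b i * A' j)
        (0\<^sub>m n 1 * ?c j + A' i * 0\<^sub>m n 1) (0\<^sub>m n 1 * b j + A' i * A' j)"
    if ij: "i \<in> S" "j \<in> S" for i j
    unfolding conjugate_mult[OF Suc.prems(1)[OF ij(1)] Suc.prems(1)[OF ij(2)] PQ(1,2,4), symmetric]
      block[OF ij(1)] block[OF ij(2)]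
    by (rule mult_four_block_mat[OF cc b[OF ij(1)] zero_carrier_mat A'[OF ij(1)]
          cc b[OF ij(2)] zero_carrier_mat A'[OF ij(2)]])
  have entry: "(A' i * A' j) $$ (r, s) = (P * (A i * A j) * Q) $$ (Suc r, Suc s)"
    if "i \<in> S" "j \<in> S" "r < n" "s < n" for i j r s
  proof -
    have "0\<^sub>m n 1 * b j = 0\<^sub>m n n" using b[OF that(2)] by auto
    then show ?thesis
      using that A'[OF that(1)] A'[OF that(2)] b[OF that(1)] b[OF that(2)]
      by (subst prod) (auto simp: four_block_mat_def Let_def simp del: index_mult_mat(1))
  qed
  have "A' i * A' j = A' j * A' i" if ij: "i \<in> S" "j \<in> S" for i j
    using A'[OF ij(1)] A'[OF ij(2)] Suc.prems(2)[OF ij]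
    by (intro eq_matI) (auto simp: entry[OF ij] entry[OF ij(2,1)] simp del: index_mult_mat(1))
  from Suc.IH[of A', OF A' this] obtain P' Q' where PQ': "P' \<in> carrier_mat n n" "Q' \<in> carrier_mat n n"
    "P' * Q' = 1\<^sub>m n" "Q' * P' = 1\<^sub>m n" and tri: "\<And>i. i \<in> S \<Longrightarrow> upper_triangular (P' * A' i * Q')"
    by blast
  define E :: "'a mat \<Rightarrow> 'a mat" where
    "E Z = four_block_mat (1\<^sub>m 1) (0\<^sub>m 1 n) (0\<^sub>m n 1) Z" for Z
  have ext: "E B \<in> carrier_mat (Suc n) (Suc n)" if "B \<in> carrier_mat n n" for B :: "'a mat"
    using four_block_carrier_mat[OF one_carrier_mat that, of 1] by (simp add: E_def)
  have ext_mult: "E B * E C = E (B * C)" if "B \<in> carrier_mat n n" "C \<in> carrier_mat n n"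
    for B C :: "'a mat"
    using that unfolding E_def by (subst mult_four_block_mat[of _ 1 1 _ n _ n _ _ 1 _ n]) auto
  have ext_one: "E (1\<^sub>m n) = (1\<^sub>m (Suc n) :: 'a mat)"
    using four_block_one_mat[of 1 n] by (simp add: E_def)
  have "upper_triangular ((E P' * P) * A i * (Q * E Q'))" if i: "i \<in> S" for i
  proof -
    have "(E P' * P) * A i * (Q * E Q') = E P' * (P * A i * Q) * E Q'"
      using PQ(1,2) ext[OF PQ'(1)] ext[OF PQ'(2)] Suc.prems(1)[OF i]
      by (simp add: assoc_mult_mat[of _ "Suc n" "Suc n" _ "Suc n" _ "Suc n"])
    also have "\<dots> = four_block_mat (?c i) (b i * Q') (0\<^sub>m n 1) (P' * A' i * Q')"
      unfolding block[OF i] E_def using PQ'(1,2) b[OF i] A'[OF i] cc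
      by (subst mult_four_block_mat[of _ 1 1 _ n _ n _ _ 1 _ n], simp_all,
          subst mult_four_block_mat[of _ 1 1 _ n _ n _ _ 1 _ n], simp_all)
    also have "upper_triangular \<dots>"
      by (rule upper_triangular_four_block[of _ 1 _ n]) (use tri[OF i] PQ' A'[OF i] in auto)
    finally show ?thesis .
  qed
  moreover have "(E P' * P) * (Q * E Q') = E P' * (P * Q) * E Q'"
    using PQ(1,2) ext[OF PQ'(1)] ext[OF PQ'(2)]
    by (simp add: assoc_mult_mat[of _ "Suc n" "Suc n" _ "Suc n" _ "Suc n"])
  then have "(E P' * P) * (Q * E Q') = 1\<^sub>m (Suc n)"
    using PQ(3) ext[OF PQ'(1)] ext_mult[OF PQ'(1,2)] PQ'(3) ext_one by simp
  moreover have "(Q * E Q') * (E P' * P) = Q * (E Q' * E P') * P"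
    using PQ(1,2) ext[OF PQ'(1)] ext[OF PQ'(2)]
    by (simp add: assoc_mult_mat[of _ "Suc n" "Suc n" _ "Suc n" _ "Suc n"])
  then have "(Q * E Q') * (E P' * P) = 1\<^sub>m (Suc n)"
    using PQ(1,2,4) ext_mult[OF PQ'(2,1)] PQ'(4) ext_one by simp
  moreover have "E P' * P \<in> carrier_mat (Suc n) (Suc n)" "Q * E Q' \<in> carrier_mat (Suc n) (Suc n)"
    using PQ(1,2) ext[OF PQ'(1)] ext[OF PQ'(2)] by auto
  ultimately show ?case by blast
qed

primrec mat_prod :: "nat \<Rightarrow> (nat \<Rightarrow> 'a::semiring_1 mat) \<Rightarrow> nat \<Rightarrow> 'a mat" where
  "mat_prod n T 0 = 1\<^sub>m n"
| "mat_prod n T (Suc k) = mat_prod n T k * T k"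

lemma mat_prod_carrier:
  "(\<And>j. j < k \<Longrightarrow> T j \<in> carrier_mat n n) \<Longrightarrow> mat_prod n T k \<in> carrier_mat n n"
  by (induction k) auto

text \<open>The factor \<open>T j\<close> maps the span of the first \<open>j + 1\<close> unit vectors into the span of the first \<open>j\<close>.
  Hence the first \<open>k\<close> columns of \<open>T 0 \<cdots> T (k - 1)\<close> are zero. The special case
  \<open>T j = A - a\<^bsub>jj\<^esub>\<close> is the Cayley--Hamilton theorem for triangular matrices.\<close>

lemma mat_prod_triangular_zero:
  fixes T :: "nat \<Rightarrow> 'a::comm_ring_1 mat"
  assumes T: "\<And>j. j < n \<Longrightarrow> T j \<in> carrier_mat n n" and tri: "\<And>j. j < n \<Longrightarrow> upper_triangular (T j)"
    and diag: "\<And>j. j < n \<Longrightarrow> T j $$ (j, j) = 0"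
  shows "mat_prod n T n = 0\<^sub>m n n"
proof -
  have "mat_prod n T k $$ (r, c) = 0" if "k \<le> n" "r < n" "c < k" for k r c
    using that
  proof (induction k arbitrary: r c)
    case (Suc k)
    have W: "mat_prod n T k \<in> carrier_mat n n" using Suc.prems T by (intro mat_prod_carrier) auto
    have Tk: "T k \<in> carrier_mat n n" using Suc.prems T by auto
    have "mat_prod n T k $$ (r, s) * T k $$ (s, c) = 0" if "s < n" for s
    proof (cases "s < k")
      case True
      then show ?thesis using Suc by auto
    next
      case False
      then have "T k $$ (s, c) = 0"
        using Suc.prems that diag[of k] upper_triangularD[OF tri[of k], of c s] Tk
        by (cases "s = c") (auto simp: less_Suc_eq)
      then show ?thesis by simp
    qed
    then show ?case using W Tk Suc.prems by (auto simp: scalar_prod_def intro!: sum.neutral)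
  qed simp
  then show ?thesis using mat_prod_carrier[of n T n] T by (intro eq_matI) auto
qed

lemma mat_prod_conjugate:
  fixes T :: "nat \<Rightarrow> 'a::semiring_1 mat"
  assumes PQ: "P \<in> carrier_mat n n" "Q \<in> carrier_mat n n" "P * Q = 1\<^sub>m n" "Q * P = 1\<^sub>m n"
    and T: "\<And>j. j < k \<Longrightarrow> T j \<in> carrier_mat n n"
  shows "mat_prod n (\<lambda>j. P * T j * Q) k = P * mat_prod n T k * Q"
  using T
proof (induction k)
  case (Suc k)
  then have "mat_prod n T k \<in> carrier_mat n n" by (intro mat_prod_carrier) auto
  from conjugate_mult[OF this _ PQ(1,2,4), of "T k"] show ?case using Suc by simp
qed (use PQ in auto)

section \<open>Bihomogeneous polynomials and ideals\<close>

lemma poly_mapping_eq_sum_single: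
  fixes f :: "'a \<Rightarrow>\<^sub>0 'b::comm_monoid_add"
  shows "f = (\<Sum>t\<in>Poly_Mapping.keys f. Poly_Mapping.single t (Poly_Mapping.lookup f t))"
proof (rule poly_mapping_eqI)
  fix u
  have "Poly_Mapping.lookup (\<Sum>t\<in>Poly_Mapping.keys f. Poly_Mapping.single t (Poly_Mapping.lookup f t)) u
      = (\<Sum>t\<in>Poly_Mapping.keys f. if t = u then Poly_Mapping.lookup f t else 0)"
    by (simp add: lookup_sum lookup_single when_def)
  also have "\<dots> = Poly_Mapping.lookup f u"
    by (simp add: in_keys_iff)
  finally show "Poly_Mapping.lookup f u = Poly_Mapping.lookup
      (\<Sum>t\<in>Poly_Mapping.keys f. Poly_Mapping.single t (Poly_Mapping.lookup f t)) u" ..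
qed

text \<open>Only the terms that occur in \<open>f\<close> have to be treated, so that the induction can be used for
  properties of polynomials of a fixed bidegree.\<close>

lemma additive_induct [case_names zero add single]:
  fixes f :: "'a \<Rightarrow>\<^sub>0 'b::comm_monoid_add"
  assumes "P 0" and "\<And>f g. P f \<Longrightarrow> P g \<Longrightarrow> P (f + g)"
    and "\<And>t. t \<in> Poly_Mapping.keys f \<Longrightarrow> P (Poly_Mapping.single t (Poly_Mapping.lookup f t))"
  shows "P f"
proof -
  have "P (\<Sum>t\<in>A. Poly_Mapping.single t (Poly_Mapping.lookup f t))" if "A \<subseteq> Poly_Mapping.keys f" for A
    using finite_subset[OF that finite_keys] that
    by (induction A rule: finite_induct) (use assms in auto)
  then show ?thesis by (subst poly_mapping_eq_sum_single) auto
qed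

lemma xdeg_add [simp]: "xdeg (s + t) = xdeg s + xdeg t"
  by (simp add: xdeg_def lookup_add sum.distrib)

lemma ydeg_add [simp]: "ydeg (s + t) = ydeg s + ydeg t"
  by (simp add: ydeg_def lookup_add sum.distrib)

lemma xdeg_0 [simp]: "xdeg 0 = 0" and ydeg_0 [simp]: "ydeg 0 = 0"
  by (simp_all add: xdeg_def ydeg_def)

lemma xdeg_single [simp]: "xdeg (Poly_Mapping.single v k) = (case v of Inl _ \<Rightarrow> k | Inr _ \<Rightarrow> 0)"
  by (cases v) (auto simp: xdeg_def lookup_single when_def)

lemma ydeg_single [simp]: "ydeg (Poly_Mapping.single v k) = (case v of Inl _ \<Rightarrow> 0 | Inr _ \<Rightarrow> k)"
  by (cases v) (auto simp: ydeg_def lookup_single when_def)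

lemma divide_out_variable:
  assumes "Poly_Mapping.lookup t v \<noteq> (0::nat)"
  shows "t = (t - Poly_Mapping.single v 1) + Poly_Mapping.single v 1"
  using assms by (intro poly_mapping_eqI) (auto simp: lookup_add lookup_minus lookup_single when_def)

lemma xdeg_pos: "xdeg t > 0 \<Longrightarrow> \<exists>i. Poly_Mapping.lookup t (Inl i) \<noteq> 0"
  unfolding xdeg_def by (metis gr_implies_not0 sum.neutral)

lemma ydeg_pos: "ydeg t > 0 \<Longrightarrow> \<exists>j. Poly_Mapping.lookup t (Inr j) \<noteq> 0"
  unfolding ydeg_def by (metis gr_implies_not0 sum.neutral)

lemma power_product_split_x:
  assumes "xdeg t = c + e"
  shows "\<exists>t1 t2. t = t1 + t2 \<and> xdeg t1 = c \<and> ydeg t1 = ydeg t \<and> xdeg t2 = e \<and> ydeg t2 = 0"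
  using assms
proof (induction e arbitrary: t)
  case 0
  then show ?case by (intro exI[of _ t] exI[of _ 0]) auto
next
  case (Suc e)
  then obtain i where i: "Poly_Mapping.lookup t (Inl i) \<noteq> 0" using xdeg_pos[of t] by auto
  let ?u = "Poly_Mapping.single (Inl i) 1 :: 'a + 'b \<Rightarrow>\<^sub>0 nat"
  have t: "t = (t - ?u) + ?u" by (rule divide_out_variable[OF i])
  have "xdeg t = xdeg (t - ?u) + 1" "ydeg t = ydeg (t - ?u)" by (subst t, simp)+
  with Suc.IH[of "t - ?u"] Suc.prems obtain t1 t2 where s: "t - ?u = t1 + t2" "xdeg t1 = c" "ydeg t1 = ydeg t"
    "xdeg t2 = e" "ydeg t2 = 0" by auto
  with t show ?case by (intro exI[of _ t1] exI[of _ "t2 + ?u"]) (auto simp: add.assoc)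
qed

lemma power_product_split_y:
  assumes "ydeg t = c + e"
  shows "\<exists>t1 t2. t = t1 + t2 \<and> ydeg t1 = c \<and> xdeg t1 = 0"
  using assms
proof (induction c arbitrary: t)
  case 0
  then show ?case by (intro exI[of _ 0] exI[of _ t]) auto
next
  case (Suc c)
  then obtain j where j: "Poly_Mapping.lookup t (Inr j) \<noteq> 0" using ydeg_pos[of t] by auto
  let ?u = "Poly_Mapping.single (Inr j) 1 :: 'a + 'b \<Rightarrow>\<^sub>0 nat"
  have t: "t = (t - ?u) + ?u" by (rule divide_out_variable[OF j])
  have "ydeg t = ydeg (t - ?u) + 1" by (subst t, simp)
  with Suc.IH[of "t - ?u"] Suc.prems obtain t1 t2 where s: "t - ?u = t1 + t2" "ydeg t1 = c" "xdeg t1 = 0"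
    by auto
  with t show ?case by (intro exI[of _ "t1 + ?u"] exI[of _ "t2"]) (auto simp: ac_simps)
qed

text \<open>Every exponent of such a power product is at most \<open>a + b\<close>.\<close>

lemma finite_bidegree: "finite {t :: 'x::finite + 'y::finite \<Rightarrow>\<^sub>0 nat. xdeg t = a \<and> ydeg t = b}"
proof -
  let ?F = "{f :: 'x + 'y \<Rightarrow> nat. \<forall>v. (v \<in> UNIV \<longrightarrow> f v \<in> {..a + b}) \<and> (v \<notin> UNIV \<longrightarrow> f v = 0)}"
  have "finite ?F" by (rule finite_set_of_finite_funs) auto
  moreover have "Poly_Mapping.lookup t v \<le> xdeg t + ydeg t" for t :: "'x + 'y \<Rightarrow>\<^sub>0 nat" and v
  proof (cases v)
    case (Inl i)
    then show ?thesis unfolding xdeg_def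
      using member_le_sum[of i UNIV "\<lambda>i. Poly_Mapping.lookup t (Inl i)"] by auto
  next
    case (Inr j)
    then show ?thesis unfolding ydeg_def
      using member_le_sum[of j UNIV "\<lambda>i. Poly_Mapping.lookup t (Inr i)"] by auto
  qed
  then have "Poly_Mapping.lookup ` {t :: 'x + 'y \<Rightarrow>\<^sub>0 nat. xdeg t = a \<and> ydeg t = b} \<subseteq> ?F" by auto
  ultimately have "finite (Poly_Mapping.lookup ` {t :: 'x + 'y \<Rightarrow>\<^sub>0 nat. xdeg t = a \<and> ydeg t = b})"
    by (rule finite_subset[rotated])
  then show ?thesis by (rule finite_imageD) (auto simp: inj_on_def poly_mapping_eqI)
qed

lemma bihom_0 [simp]: "0 \<in> bihom a b"
  by (simp add: bihom_def)

lemma bihom_diff: "f \<in> bihom a b \<Longrightarrow> g \<in> bihom a b \<Longrightarrow> f - g \<in> bihom a b"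
  using bihom_add[of f a b "- g"] bihom_uminus[of g a b] by simp

lemma bihom_sum: "(\<And>i. i \<in> A \<Longrightarrow> f i \<in> bihom a b) \<Longrightarrow> sum f A \<in> bihom a b"
  by (induction A rule: infinite_finite_induct) (auto intro: bihom_add)

lemma bihom_single: "xdeg t = a \<Longrightarrow> ydeg t = b \<Longrightarrow> Poly_Mapping.single t c \<in> bihom a b"
  by (auto simp: bihom_def)

lemma bihom_1 [simp]: "1 \<in> bihom 0 0"
  using bihom_single[of 0 0 0 1] by simp

lemma bihom_var [simp]: "var (Inl i) \<in> bihom 1 0"
  unfolding var_def by (auto intro: bihom_single)

lemma bihom_mult:
  assumes "f \<in> bihom a b" "g \<in> bihom c d"
  shows "f * g \<in> bihom (a + c) (b + d)"
  using assms Poly_Mapping.keys_mult[of f g] by (fastforce simp: bihom_def)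

lemma bihom_mult_x: "f \<in> bihom c 0 \<Longrightarrow> g \<in> bihom a b \<Longrightarrow> f * g \<in> bihom (a + c) b"
  using bihom_mult[of f c 0 g a b] by (simp add: add.commute)

lemma bihom_power: "f \<in> bihom 1 0 \<Longrightarrow> f ^ d \<in> bihom d 0"
  by (induction d) (auto dest: bihom_mult)

definition bicomponent :: "nat \<Rightarrow> nat \<Rightarrow> ('x::finite, 'y::finite, 'k::field) bipoly \<Rightarrow> ('x, 'y, 'k) bipoly" where
  "bicomponent a b f = Abs_poly_mapping (\<lambda>t. Poly_Mapping.lookup f t when (xdeg t = a \<and> ydeg t = b))"

lemma lookup_bicomponent:
  "Poly_Mapping.lookup (bicomponent a b f) t = (if xdeg t = a \<and> ydeg t = b then Poly_Mapping.lookup f t else 0)"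
proof -
  have "finite {t. (Poly_Mapping.lookup f t when (xdeg t = a \<and> ydeg t = b)) \<noteq> 0}"
    by (rule finite_subset[OF _ finite_keys[of f]]) (auto simp: in_keys_iff when_def)
  then show ?thesis by (simp add: bicomponent_def when_def)
qed

lemma bicomponent_0 [simp]: "bicomponent a b 0 = 0"
  by (rule poly_mapping_eqI) (simp add: lookup_bicomponent)

lemma bicomponent_add: "bicomponent a b (f + g) = bicomponent a b f + bicomponent a b g"
  by (rule poly_mapping_eqI) (simp add: lookup_bicomponent lookup_add)

lemma bicomponent_bihom: "bicomponent a b f \<in> bihom a b"
  by (auto simp: bihom_def in_keys_iff lookup_bicomponent split: if_splits)

lemma bicomponent_of_bihom: "f \<in> bihom c d \<Longrightarrow> bicomponent a b f = (if c = a \<and> d = b then f else 0)"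
  by (intro poly_mapping_eqI) (auto simp: bihom_def in_keys_iff lookup_bicomponent)

text \<open>For a monomial \<open>f\<close> both sides are \<open>s f\<close> or \<open>0\<close>, and both sides are additive in \<open>f\<close>.\<close>

lemma bicomponent_mult:
  assumes s: "s \<in> bihom c d"
  shows "bicomponent a b (s * f) = (if c \<le> a \<and> d \<le> b then s * bicomponent (a - c) (b - d) f else 0)"
proof (induction f rule: additive_induct)
  case (add f g)
  then show ?case by (auto simp: bicomponent_add distrib_left)
next
  case (single t)
  define u where "u = Poly_Mapping.single t (Poly_Mapping.lookup f t)"
  have u: "u \<in> bihom (xdeg t) (ydeg t)" unfolding u_def by (rule bihom_single) auto
  show ?case unfolding u_def[symmetric] bicomponent_of_bihom[OF u] bicomponent_of_bihom[OF bihom_mult[OF s u]]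
    by auto
qed auto

lemma bicomponent_sum: "f = (\<Sum>(a, b)\<in>(\<lambda>t. (xdeg t, ydeg t)) ` Poly_Mapping.keys f. bicomponent a b f)"
proof (rule poly_mapping_eqI)
  fix u
  let ?D = "(\<lambda>t. (xdeg t, ydeg t)) ` Poly_Mapping.keys f"
  have "Poly_Mapping.lookup (\<Sum>(a, b)\<in>?D. bicomponent a b f) u
      = (\<Sum>p\<in>?D. if p = (xdeg u, ydeg u) then Poly_Mapping.lookup f u else 0)"
    unfolding lookup_sum by (intro sum.cong) (auto simp: lookup_bicomponent split: prod.splits)
  also have "\<dots> = Poly_Mapping.lookup f u"
    by (subst sum.delta) (auto simp: in_keys_iff)
  finally show "Poly_Mapping.lookup f u = Poly_Mapping.lookup (\<Sum>(a, b)\<in>?D. bicomponent a b f) u" ..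
qed

lemma class_ring_a_inv: "a_inv (class_ring :: 'a::ring_1 ring) = uminus"
  by (fact class_ring_simps)

lemma ideal_class_ring_iff:
  fixes J :: "'a::comm_ring_1 set"
  shows "ideal J (class_ring :: 'a ring) \<longleftrightarrow>
    0 \<in> J \<and> (\<forall>f\<in>J. \<forall>g\<in>J. f + g \<in> J) \<and> (\<forall>r. \<forall>f\<in>J. r * f \<in> J)" (is "?L \<longleftrightarrow> ?R")
proof
  assume ?L
  then interpret ideal J "class_ring :: 'a ring" .
  show ?R using I_l_closed a_closed zero_closed by auto
next
  assume R: ?R
  show ?L
  proof (rule idealI)
    show "ring (class_ring :: 'a ring)" by (rule class_ring.ring_axioms)
    have "- f \<in> J" if "f \<in> J" for f
      using R that mult_minus1[of f] by metis
    moreover have "inv\<^bsub>add_monoid (class_ring :: 'a ring)\<^esub> f = - f" for f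
      using fun_cong[OF class_ring_a_inv[where 'a = 'a], of f] by (simp add: a_inv_def)
    ultimately show "subgroup J (add_monoid class_ring)"
      using R by (auto simp: subgroup_def)
  next
    fix f r assume "f \<in> J"
    then have "r * f \<in> J" using R by blast
    then show "r \<otimes>\<^bsub>class_ring\<^esub> f \<in> J" "f \<otimes>\<^bsub>class_ring\<^esub> r \<in> J" by (simp_all add: mult.commute)
  qed
qed

text \<open>An ideal is spanned, as an additive group, by the products of monomials with generators. This is
  the form of generation that is compatible with bidegrees.\<close>

lemma genideal_induct [consumes 1, case_names zero add single]:
  fixes S :: "('x, 'y, 'k::field) bipoly set"
  assumes f: "f \<in> genideal class_ring S" and P0: "P 0" and add: "\<And>f g. P f \<Longrightarrow> P g \<Longrightarrow> P (f + g)"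
    and single: "\<And>s t c. s \<in> S \<Longrightarrow> P (Poly_Mapping.single t c * s)"
  shows "P f"
proof -
  \<comment> \<open>Quantifying over all monomial multiples turns the property into an ideal.\<close>
  let ?K = "{f. \<forall>t c. P (Poly_Mapping.single t c * f)}"
  have "P (Poly_Mapping.single t c * (r * f))" if "f \<in> ?K" for r t c f
  proof (induction r rule: additive_induct)
    case (single u)
    show ?case using that by (simp add: mult.assoc[symmetric] mult_single)
  qed (auto simp: distrib_right distrib_left P0 add)
  then have "ideal ?K class_ring"
    unfolding ideal_class_ring_iff using P0 add by (auto simp: distrib_left)
  then have "genideal class_ring S \<subseteq> ?K"
    by (rule ring.genideal_minimal[OF class_ring.ring_axioms]) (use single in auto)
  with f have "P (Poly_Mapping.single 0 1 * f)" by blast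
  then show ?thesis by simp
qed

lemma const_poly_simps:
  "const_poly 0 = 0" "const_poly 1 = 1" "const_poly (c + d) = const_poly c + const_poly d"
  "const_poly (c * d) = const_poly c * const_poly d" "const_poly (- c) = - const_poly c"
  "const_poly (c - d) = const_poly c - const_poly d"
  by (auto simp: const_poly_def single_add mult_single single_uminus single_diff)

lemma const_poly_sum: "const_poly (sum c A) = (\<Sum>i\<in>A. const_poly (c i))"
  by (induction A rule: infinite_finite_induct) (auto simp: const_poly_simps)

lemma const_poly_times_single: "const_poly c * Poly_Mapping.single t d = Poly_Mapping.single t (c * d)"
  by (simp add: const_poly_def mult_single)

section \<open>Graded pieces of a quotient and bases modulo an ideal\<close>

locale poly_ideal =
  fixes I :: "('x::finite, 'y::finite, 'k::field) bipoly set"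
  assumes is_ideal: "ideal I class_ring"
begin

lemma zero_mem [simp]: "0 \<in> I"
  and add_mem: "f \<in> I \<Longrightarrow> g \<in> I \<Longrightarrow> f + g \<in> I"
  and mult_mem: "f \<in> I \<Longrightarrow> r * f \<in> I"
  using is_ideal unfolding ideal_class_ring_iff by blast+

lemma uminus_mem: "f \<in> I \<Longrightarrow> - f \<in> I"
  using mult_mem[of f "- 1"] by simp

lemma diff_mem: "f \<in> I \<Longrightarrow> g \<in> I \<Longrightarrow> f - g \<in> I"
  using add_mem[of f "- g"] uminus_mem[of g] by simp

lemma sum_mem: "(\<And>i. i \<in> A \<Longrightarrow> f i \<in> I) \<Longrightarrow> sum f A \<in> I"
  by (induction A rule: infinite_finite_induct) (auto intro: add_mem)

lemma diff_mem_iff: "f - g \<in> I \<Longrightarrow> f \<in> I \<longleftrightarrow> g \<in> I"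
  using diff_mem[of f "f - g"] add_mem[of "f - g" g] by auto

lemma diff_mem_trans: "f - g \<in> I \<Longrightarrow> g - k \<in> I \<Longrightarrow> f - k \<in> I"
  using add_mem[of "f - g" "g - k"] by simp

lemma diff_mem_sym: "f - g \<in> I \<Longrightarrow> g - f \<in> I"
  using uminus_mem[of "f - g"] by simp

lemma diff_mult_mem: "f - g \<in> I \<Longrightarrow> r * f - r * g \<in> I"
  using mult_mem[of "f - g" r] by (simp add: right_diff_distrib)

lemma residue_class_eq_iff: "residue_class I f = residue_class I g \<longleftrightarrow> f - g \<in> I"
proof -
  have mem: "u \<in> residue_class I v \<longleftrightarrow> u - v \<in> I" for u v
    by (auto simp: residue_class_def a_r_coset_def r_coset_def intro: bexI[of _ "u - v"])
  show ?thesis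
  proof
    assume "residue_class I f = residue_class I g"
    then show "f - g \<in> I" using mem[of f f] mem[of f g] by simp
  next
    assume fg: "f - g \<in> I"
    show "residue_class I f = residue_class I g"
      using diff_mem_trans[OF _ fg] diff_mem_trans[OF _ diff_mem_sym[OF fg]] by (auto simp: mem)
  qed
qed

lemma residue_class_hom:
  "residue_class I f \<oplus>\<^bsub>class_ring Quot I\<^esub> residue_class I g = residue_class I (f + g)"
  "residue_class I f \<otimes>\<^bsub>class_ring Quot I\<^esub> residue_class I g = residue_class I (f * g)"
  "\<zero>\<^bsub>class_ring Quot I\<^esub> = residue_class I 0"
proof -
  interpret ideal I "class_ring :: ('x, 'y, 'k) bipoly ring" by (rule is_ideal)
  interpret h: ring_hom_ring "class_ring :: ('x, 'y, 'k) bipoly ring" "class_ring Quot I" "residue_class I"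
    using rcos_ring_hom_ring unfolding residue_class_def[abs_def] .
  show "residue_class I f \<oplus>\<^bsub>class_ring Quot I\<^esub> residue_class I g = residue_class I (f + g)"
    using h.hom_add[of f g] by simp
  show "residue_class I f \<otimes>\<^bsub>class_ring Quot I\<^esub> residue_class I g = residue_class I (f * g)"
    using h.hom_mult[of f g] by simp
  show "\<zero>\<^bsub>class_ring Quot I\<^esub> = residue_class I 0" using h.hom_zero by simp
qed

lemma quot_mult_residue_class: "quot_mult I g (residue_class I f) = residue_class I (g * f)"
  by (simp add: quot_mult_def residue_class_hom)

abbreviation (input) V where "V c d \<equiv> quot_comp I c d"

lemma quot_comp_simps:
  "carrier (V c d) = residue_class I ` bihom c d"
  "residue_class I f \<oplus>\<^bsub>V c d\<^esub> residue_class I g = residue_class I (f + g)"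
  "\<zero>\<^bsub>V c d\<^esub> = residue_class I 0"
  "e \<odot>\<^bsub>V c d\<^esub> residue_class I f = residue_class I (const_poly e * f)"
  by (simp_all add: quot_comp_def residue_class_hom quot_mult_residue_class)

lemma vs: "vectorspace (class_ring :: 'k ring) (V c d)"
  by (rule vectorspace_quot_comp[OF is_ideal])

lemma finsum_residue_class:
  assumes "\<And>i. i \<in> A \<Longrightarrow> g i \<in> bihom c d"
  shows "(\<Oplus>\<^bsub>V c d\<^esub>i\<in>A. residue_class I (g i)) = residue_class I (sum g A)"
proof -
  interpret vectorspace "class_ring :: 'k ring" "V c d" by (rule vs)
  show ?thesis using assms
  proof (induction A rule: infinite_finite_induct)
    case (insert i A)
    have "residue_class I (g j) \<in> carrier (V c d)" if "j \<in> insert i A" for j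
      using insert.prems[OF that] by (auto simp: quot_comp_simps)
    with insert show ?case by (subst M.finsum_insert) (auto simp: quot_comp_simps(2))
  qed (auto simp: quot_comp_simps)
qed

lemma lincomb_residue_class:
  assumes "distinct bs" and f: "\<And>i. i < length bs \<Longrightarrow> f i \<in> bihom c d \<and> bs ! i = residue_class I (f i)"
  shows "(\<Oplus>\<^bsub>V c d\<^esub>v\<in>set bs. e v \<odot>\<^bsub>V c d\<^esub> v)
    = residue_class I (\<Sum>i<length bs. const_poly (e (bs ! i)) * f i)"
proof -
  interpret vectorspace "class_ring :: 'k ring" "V c d" by (rule vs)
  let ?N = "length bs"
  have inj: "inj_on ((!) bs) {..<?N}" using assms(1) by (auto simp: inj_on_def nth_eq_iff_index_eq)
  have set: "set bs = (!) bs ` {..<?N}" by (auto simp: set_conv_nth)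
  have "e v \<odot>\<^bsub>V c d\<^esub> v \<in> carrier (V c d)" if v: "v \<in> set bs" for v
  proof -
    obtain i where i: "i < ?N" "v = bs ! i" using v by (auto simp: set_conv_nth)
    have "const_poly (e v) * f i \<in> bihom c d" using f[OF i(1)] by (auto intro: bihom_const)
    then show ?thesis using f[OF i(1)] i(2) by (auto simp: quot_comp_simps)
  qed
  then have "(\<Oplus>\<^bsub>V c d\<^esub>v\<in>set bs. e v \<odot>\<^bsub>V c d\<^esub> v) = (\<Oplus>\<^bsub>V c d\<^esub>i\<in>{..<?N}. e (bs ! i) \<odot>\<^bsub>V c d\<^esub> (bs ! i))"
    unfolding set by (subst M.finsum_reindex[OF _ inj]) auto
  also have "\<dots> = (\<Oplus>\<^bsub>V c d\<^esub>i\<in>{..<?N}. residue_class I (const_poly (e (bs ! i)) * f i))"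
    using f by (intro M.finsum_cong') (auto simp: quot_comp_simps intro: bihom_const)
  also have "\<dots> = residue_class I (\<Sum>i<?N. const_poly (e (bs ! i)) * f i)"
    using f by (intro finsum_residue_class) (auto intro: bihom_const)
  finally show ?thesis .
qed

text \<open>The classes of the finitely many monomials of the bidegree generate.\<close>

lemma fin_dim_quot_comp: "vectorspace.fin_dim (class_ring :: 'k ring) (V c d)"
proof -
  interpret vectorspace "class_ring :: 'k ring" "V c d" by (rule vs)
  let ?A = "(\<lambda>t. residue_class I (Poly_Mapping.single t 1)) ` {t. xdeg t = c \<and> ydeg t = d}"
  have A: "?A \<subseteq> carrier (V c d)" by (auto simp: quot_comp_simps intro: bihom_single)
  have "residue_class I f \<in> span ?A" if f: "f \<in> bihom c d" for f
  proof (induction f rule: additive_induct)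
    case zero
    then show ?case using span_zero by (simp add: quot_comp_simps)
  next
    case (add f g)
    then show ?case using span_add1[OF A add] by (simp add: quot_comp_simps)
  next
    case (single t)
    let ?s = "residue_class I (Poly_Mapping.single t 1)"
    have "?s \<in> span ?A" using f single A by (intro span_mem) (auto simp: bihom_def)
    then have "Poly_Mapping.lookup f t \<odot>\<^bsub>V c d\<^esub> ?s \<in> span ?A"
      using span_is_submodule[OF A] by (auto simp: submodule_def)
    then show ?case by (simp add: quot_comp_simps const_poly_times_single)
  qed
  then have "gen_set ?A" using span_closed[OF A] by (auto simp: quot_comp_simps)
  then show ?thesis unfolding fin_dim_def
    by (intro exI[of _ ?A] conjI A) (intro finite_imageI finite_bidegree)
qed

text \<open>The classes of \<open>f 0, \<dots>, f (N - 1)\<close> are a basis of the component of bidegree \<open>(c, d)\<close>. Lifting bases to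
  polynomials replaces linear algebra in the quotient by congruences modulo \<open>I\<close>.\<close>

definition basis_mod :: "nat \<Rightarrow> nat \<Rightarrow> nat \<Rightarrow> (nat \<Rightarrow> ('x, 'y, 'k) bipoly) \<Rightarrow> bool" where
  "basis_mod c d N f \<longleftrightarrow> (\<forall>r<N. f r \<in> bihom c d) \<and>
     (\<forall>g\<in>bihom c d. \<exists>e. g - (\<Sum>r<N. const_poly (e r) * f r) \<in> I) \<and>
     (\<forall>e. (\<Sum>r<N. const_poly (e r) * f r) \<in> I \<longrightarrow> (\<forall>r<N. e r = 0))"

lemma basis_mod_of_basis:
  assumes bs: "distinct bs" "vectorspace.basis (class_ring :: 'k ring) (V c d) (set bs)"
  obtains f where "basis_mod c d (length bs) f" "\<And>i. i < length bs \<Longrightarrow> bs ! i = residue_class I (f i)"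
    "HF I c d = length bs"
proof -
  interpret vectorspace "class_ring :: 'k ring" "V c d" by (rule vs)
  let ?N = "length bs"
  have carr: "set bs \<subseteq> carrier (V c d)" and li: "lin_indpt (set bs)" and gen: "gen_set (set bs)"
    using bs(2) by (auto simp: basis_def)
  have "\<exists>g. g \<in> bihom c d \<and> bs ! i = residue_class I g" if "i < ?N" for i
    using carr nth_mem[OF that] by (auto simp: quot_comp_simps)
  then obtain f where f: "\<And>i. i < ?N \<Longrightarrow> f i \<in> bihom c d \<and> bs ! i = residue_class I (f i)" by metis
  note lc = lincomb_residue_class[OF bs(1) f]
  have "\<exists>e. g - (\<Sum>r<?N. const_poly (e r) * f r) \<in> I" if g: "g \<in> bihom c d" for g
  proof -
    have "residue_class I g \<in> span (set bs)" using g gen by (auto simp: quot_comp_simps)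
    then obtain e where "residue_class I g = lincomb e (set bs)"
      using finite_span[of "set bs"] carr by auto
    also have "lincomb e (set bs) = residue_class I (\<Sum>r<?N. const_poly (e (bs ! r)) * f r)"
      unfolding lincomb_def by (rule lc)
    finally show ?thesis unfolding residue_class_eq_iff by (intro exI[of _ "\<lambda>r. e (bs ! r)"])
  qed
  moreover have "e r = 0" if e: "(\<Sum>r<?N. const_poly (e r) * f r) \<in> I" "r < ?N" for e r
  proof (rule ccontr)
    assume "e r \<noteq> 0"
    \<comment> \<open>The coefficients, indexed by positions, become a function of the basis vectors.\<close>
    define e' where "e' v = e (THE i. i < ?N \<and> bs ! i = v)" for v
    have e': "e' (bs ! i) = e i" if "i < ?N" for i
    proof -
      have "(THE j. j < ?N \<and> bs ! j = bs ! i) = i"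
        using that bs(1) by (auto simp: nth_eq_iff_index_eq intro!: the_equality)
      then show ?thesis by (simp add: e'_def)
    qed
    have "lincomb e' (set bs) = residue_class I (\<Sum>i<?N. const_poly (e' (bs ! i)) * f i)"
      unfolding lincomb_def by (rule lc)
    also have "\<dots> = residue_class I (\<Sum>i<?N. const_poly (e i) * f i)"
      by (intro arg_cong[of _ _ "residue_class I"] sum.cong) (auto simp: e')
    also have "\<dots> = \<zero>\<^bsub>V c d\<^esub>" using e(1) by (simp add: quot_comp_simps residue_class_eq_iff)
    finally have "lin_dep (set bs)"
      unfolding lin_dep_def using \<open>e r \<noteq> 0\<close> e' e(2)
      by (intro exI[of _ "set bs"] exI[of _ e'] exI[of _ "bs ! r"]) auto
    with li show False ..
  qed
  ultimately have "basis_mod c d ?N f" unfolding basis_mod_def using f by blast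
  moreover have "bs ! i = residue_class I (f i)" if "i < ?N" for i
    using f[OF that] by (rule conjunct2)
  moreover have "HF I c d = ?N"
    unfolding HF_def using dim_basis[OF _ bs(2)] distinct_card[OF bs(1)] by simp
  ultimately show ?thesis by (rule that)
qed

lemma basis_list_exists:
  obtains bs where "distinct bs" "vectorspace.basis (class_ring :: 'k ring) (V c d) (set bs)"
proof -
  obtain B where B: "finite B" "vectorspace.basis (class_ring :: 'k ring) (V c d) B"
    using vectorspace.finite_basis_exists[OF vs fin_dim_quot_comp] by blast
  obtain bs where "set bs = B" "distinct bs" using finite_distinct_list[OF B(1)] by blast
  with B(2) show ?thesis using that by blast
qed

lemma basis_mod_exists: obtains f where "basis_mod c d (HF I c d) f"
proof -
  obtain bs where bs: "distinct bs" "vectorspace.basis (class_ring :: 'k ring) (V c d) (set bs)"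
    by (rule basis_list_exists)
  show ?thesis
  proof (rule basis_mod_of_basis[OF bs])
    fix f assume "basis_mod c d (length bs) f" "HF I c d = length bs"
    then have "basis_mod c d (HF I c d) f" by simp
    then show ?thesis by (rule that)
  qed
qed

lemma HF_zero:
  assumes "HF I c d = 0" "g \<in> bihom c d"
  shows "g \<in> I"
proof -
  obtain f where "basis_mod c d (HF I c d) f" by (rule basis_mod_exists)
  then show ?thesis using assms by (auto simp: basis_mod_def)
qed

text \<open>The matrix \<open>H\<close> describes multiplication by \<open>F\<close>, from combinations of the \<open>f s\<close> to \<open>k\<close>-multiples of
  combinations of the \<open>g r\<close>; it acts on coefficient vectors by the usual matrix--vector product.\<close>

lemma linear_combination_image:
  assumes "\<And>s. s < N \<Longrightarrow> F * f s - k * (\<Sum>r<M. const_poly (H r s) * g r) \<in> I"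
  shows "F * (\<Sum>s<N. const_poly (e s) * f s) - k * (\<Sum>r<M. const_poly (\<Sum>s<N. H r s * e s) * g r) \<in> I"
proof -
  have "(\<Sum>s<N. const_poly (e s) * (\<Sum>r<M. const_poly (H r s) * g r))
      = (\<Sum>s<N. \<Sum>r<M. const_poly (H r s * e s) * g r)"
    by (simp add: sum_distrib_left const_poly_simps ac_simps)
  also have "\<dots> = (\<Sum>r<M. \<Sum>s<N. const_poly (H r s * e s) * g r)"
    by (rule sum.swap)
  also have "\<dots> = (\<Sum>r<M. const_poly (\<Sum>s<N. H r s * e s) * g r)"
    by (simp add: sum_distrib_right const_poly_sum)
  finally have swap: "(\<Sum>s<N. const_poly (e s) * (\<Sum>r<M. const_poly (H r s) * g r))
      = (\<Sum>r<M. const_poly (\<Sum>s<N. H r s * e s) * g r)" .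
  have "F * (\<Sum>s<N. const_poly (e s) * f s) - k * (\<Sum>s<N. const_poly (e s) * (\<Sum>r<M. const_poly (H r s) * g r))
      = (\<Sum>s<N. const_poly (e s) * (F * f s - k * (\<Sum>r<M. const_poly (H r s) * g r)))"
    by (simp add: sum_distrib_left sum_subtractf right_diff_distrib mult.left_commute)
  also have "\<dots> \<in> I" using assms by (intro sum_mem mult_mem) auto
  finally show ?thesis unfolding swap .
qed

end

section \<open>Division by powers of an admissible linear form\<close>

locale admissible_bidegree =
  fixes I :: "('x::finite, 'y::finite, 'k::field) bipoly set" and a b :: nat
    and h :: "('x, 'y, 'k) bipoly"
  assumes generated: "generated_upto I a b" and admissible_h: "admissible_form I a b h"

sublocale admissible_bidegree \<subseteq> poly_ideal I
proof (rule poly_ideal.intro)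
  show "ideal I class_ring"
    using generated ring.genideal_ideal[OF class_ring.ring_axioms]
    unfolding generated_upto_def by fastforce
qed

context admissible_bidegree
begin

lemma h_bihom: "h \<in> bihom 1 0"
  using admissible_h by (simp add: admissible_form_def)

text \<open>The ideal is spanned by products of a monomial with a bihomogeneous generator, and these are
  bihomogeneous.\<close>

lemma bicomponent_mem:
  assumes "f \<in> I"
  shows "bicomponent c d f \<in> I"
proof -
  obtain S where S: "\<And>s. s \<in> S \<Longrightarrow> \<exists>a' b'. a' \<le> a \<and> b' \<le> b \<and> s \<in> bihom a' b'" and I: "I = genideal class_ring S"
    using generated unfolding generated_upto_def by auto
  have "S \<subseteq> I" unfolding I by (rule ring.genideal_self[OF class_ring.ring_axioms]) auto
  show ?thesis using assms unfolding I
  proof (induction f rule: genideal_induct)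
    case (single s t e)
    then obtain a' b' where "s \<in> bihom a' b'" using S by blast
    then have "Poly_Mapping.single t e * s \<in> bihom (xdeg t + a') (ydeg t + b')"
      by (intro bihom_mult bihom_single) auto
    moreover have "Poly_Mapping.single t e * s \<in> I" using single \<open>S \<subseteq> I\<close> by (auto intro: mult_mem)
    ultimately show ?case using zero_mem unfolding I by (simp add: bicomponent_of_bihom)
  qed (use add_mem zero_mem I in \<open>auto simp: bicomponent_add\<close>)
qed

text \<open>Taking the bidegree-\<open>(a, b)\<close> component of \<open>f = i + h r\<close> gives a quotient \<open>g\<close> of bidegree
  \<open>(a - 1, b)\<close>. For \<open>a = 0\<close> there is no such bidegree and \<open>g = 0\<close>; the second property covers both
  cases.\<close>

lemma divide_by_h:
  assumes f: "f \<in> bihom a b"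
  obtains g where "f - h * g \<in> I" "\<And>u. u \<in> bihom 1 0 \<Longrightarrow> u * g \<in> bihom a b"
proof -
  let ?J = "genideal class_ring (insert h I)"
  interpret J: poly_ideal ?J
    by (rule poly_ideal.intro, rule ring.genideal_ideal[OF class_ring.ring_axioms]) simp
  have "f \<in> ?J" using J.HF_zero[OF _ f] admissible_h by (simp add: admissible_form_def)
  then have "\<exists>i\<in>I. \<exists>r. f = i + h * r"
  proof (induction f rule: genideal_induct)
    case zero
    then show ?case by (intro bexI[of _ 0] exI[of _ 0]) auto
  next
    case (add f g)
    then obtain i r i' r' where "i \<in> I" "f = i + h * r" "i' \<in> I" "g = i' + h * r'" by blast
    then show ?case
      by (intro bexI[of _ "i + i'"] exI[of _ "r + r'"]) (auto simp: algebra_simps intro: add_mem)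
  next
    case (single s t e)
    show ?case
    proof (cases "s = h")
      case True
      then show ?thesis
        by (intro bexI[of _ 0] exI[of _ "Poly_Mapping.single t e"]) (auto simp: mult.commute)
    next
      case False
      with single show ?thesis
        by (intro bexI[of _ "Poly_Mapping.single t e * s"] exI[of _ 0]) (auto intro: mult_mem)
    qed
  qed
  then obtain i r where i: "i \<in> I" and fr: "f = i + h * r" by blast
  define g where "g = (if a = 0 then 0 else bicomponent (a - 1) b r)"
  have "f = bicomponent a b i + h * g"
    using arg_cong[OF fr, of "bicomponent a b"] f
    by (simp add: bicomponent_of_bihom bicomponent_add bicomponent_mult[OF h_bihom] g_def)
  then have "f - h * g \<in> I" using bicomponent_mem[OF i] by simp
  moreover have "u * g \<in> bihom a b" if "u \<in> bihom 1 0" for u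
    using bihom_mult_x[OF that bicomponent_bihom[of "a - 1" b r]] by (auto simp: g_def)
  ultimately show ?thesis using that by blast
qed

text \<open>A monomial of \<open>x\<close>-degree \<open>a + d + 1\<close> is a monomial of bidegree \<open>(a, b)\<close>, to which division by \<open>h\<close>
  applies, times a monomial of positive \<open>x\<close>-degree.\<close>

lemma h_surjective:
  assumes f: "f \<in> bihom (Suc (a + d)) b"
  shows "\<exists>g\<in>bihom (a + d) b. f - h * g \<in> I"
proof (induction f rule: additive_induct)
  case zero
  then show ?case by (intro bexI[of _ 0]) auto
next
  case (add f f')
  then obtain g g' where "g \<in> bihom (a + d) b" "g' \<in> bihom (a + d) b" "f - h * g \<in> I" "f' - h * g' \<in> I"
    by blast
  then show ?case using add_mem[of "f - h * g" "f' - h * g'"]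
    by (intro bexI[of _ "g + g'"]) (auto simp: algebra_simps intro: bihom_add)
next
  case (single t)
  define e where "e = Poly_Mapping.lookup f t"
  have t: "xdeg t = a + Suc d" "ydeg t = b" using f single by (auto simp: bihom_def)
  obtain t1 t2 where s: "t = t1 + t2" "xdeg t1 = a" "ydeg t1 = b" "xdeg t2 = 1 + d" "ydeg t2 = 0"
    using power_product_split_x[OF t(1)] t(2) by auto
  obtain t3 t4 where s': "t2 = t3 + t4" "xdeg t3 = 1" "ydeg t3 = 0" "xdeg t4 = d" "ydeg t4 = 0"
    using power_product_split_x[OF s(4)] s(5) by auto
  have "Poly_Mapping.single t1 1 \<in> bihom a b" using s(2,3) by (rule bihom_single)
  then obtain g where g: "Poly_Mapping.single t1 1 - h * g \<in> I" "\<And>u. u \<in> bihom 1 0 \<Longrightarrow> u * g \<in> bihom a b"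
    by (rule divide_by_h) blast
  let ?m4 = "Poly_Mapping.single t4 e" and ?m3 = "Poly_Mapping.single t3 1"
  have "?m4 * (?m3 * g) \<in> bihom (a + d) b"
    by (rule bihom_mult_x[OF bihom_single[OF s'(4,5)] g(2)[OF bihom_single[OF s'(2,3)]]])
  moreover have "Poly_Mapping.single t e = ?m4 * ?m3 * Poly_Mapping.single t1 1"
    by (simp add: mult_single s s' ac_simps)
  then have "Poly_Mapping.single t e - h * (?m4 * (?m3 * g)) \<in> I"
    using diff_mult_mem[OF g(1), of "?m4 * ?m3"] by (simp add: ac_simps)
  ultimately show ?case unfolding e_def by blast
qed

text \<open>A surjective linear map between spaces of the same finite dimension is injective: in bases, a
  right inverse of the square matrix of \<open>h\<close> is also a left inverse.\<close>

lemma h_injective: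
  assumes u: "u \<in> bihom a b" and hu: "h * u \<in> I"
  shows "u \<in> I"
proof -
  define N where "N = HF I a b"
  have HF: "HF I (Suc a) b = N" using admissible_h by (simp add: admissible_form_def N_def)
  obtain f where f: "basis_mod a b N f" using basis_mod_exists[of a b] unfolding N_def by blast
  obtain g where g: "basis_mod (Suc a) b N g" using basis_mod_exists[of "Suc a" b] unfolding HF by blast
  have "\<exists>e. h * f s - (\<Sum>r<N. const_poly (e r) * g r) \<in> I" if "s < N" for s
    using f g bihom_mult_x[OF h_bihom, of "f s" a b] that by (auto simp: basis_mod_def)
  then have "\<forall>s. \<exists>e. s < N \<longrightarrow> h * f s - (\<Sum>r<N. const_poly (e r) * g r) \<in> I"
    by blast
  from choice[OF this] obtain H' where H': "\<forall>s. s < N \<longrightarrow> h * f s - (\<Sum>r<N. const_poly (H' s r) * g r) \<in> I" ..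
  define H where "H r s = H' s r" for r s
  have H: "h * f s - (\<Sum>r<N. const_poly (H r s) * g r) \<in> I" if "s < N" for s
    using H' that by (simp add: H_def)
  have "\<exists>e. g s - h * (\<Sum>r<N. const_poly (e r) * f r) \<in> I" if s: "s < N" for s
  proof -
    have "g s \<in> bihom (Suc (a + 0)) b" using g s by (auto simp: basis_mod_def)
    then obtain k where k: "k \<in> bihom a b" "g s - h * k \<in> I" using h_surjective by fastforce
    then obtain e where "k - (\<Sum>r<N. const_poly (e r) * f r) \<in> I" using f by (auto simp: basis_mod_def)
    from diff_mem_trans[OF k(2) diff_mult_mem[OF this]] show ?thesis by blast
  qed
  then have "\<forall>s. \<exists>e. s < N \<longrightarrow> g s - h * (\<Sum>r<N. const_poly (e r) * f r) \<in> I"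
    by blast
  from choice[OF this] obtain G' where G': "\<forall>s. s < N \<longrightarrow> g s - h * (\<Sum>r<N. const_poly (G' s r) * f r) \<in> I" ..
  define G where "G r s = G' s r" for r s
  have G: "g s - h * (\<Sum>r<N. const_poly (G r s) * f r) \<in> I" if "s < N" for s
    using G' that by (simp add: G_def)
  have comb: "h * (\<Sum>r<N. const_poly (e r) * f r)
      - (\<Sum>q<N. const_poly (\<Sum>r<N. H q r * e r) * g q) \<in> I" for e
    using linear_combination_image[where N = N and M = N and F = h and k = 1 and H = H and f = f and g = g and e = e] H
    by simp
  have indep: "\<forall>r<N. e r = 0" if "(\<Sum>r<N. const_poly (e r) * g r) \<in> I" for e
    using g that by (simp add: basis_mod_def)
  let ?H = "Matrix.mat N N (\<lambda>(r, s). H r s)" and ?G = "Matrix.mat N N (\<lambda>(r, s). G r s)"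
  have "?H * ?G = 1\<^sub>m N"
  proof (rule eq_matI)
    fix q s assume "q < dim_row (1\<^sub>m N :: 'k mat)" "s < dim_col (1\<^sub>m N :: 'k mat)"
    then have q: "q < N" and s: "s < N" by auto
    let ?c = "\<lambda>q. (\<Sum>r<N. H q r * G r s) - (if q = s then 1 else 0)"
    have gs: "(\<Sum>q<N. const_poly (if q = s then 1 else 0) * g q) = g s"
    proof -
      have "(\<Sum>q<N. const_poly (if q = s then 1 else 0) * g q) = (\<Sum>q<N. if q = s then g q else 0)"
        by (intro sum.cong) (auto simp: const_poly_simps)
      then show ?thesis using s by simp
    qed
    have "g s - (\<Sum>q<N. const_poly (\<Sum>r<N. H q r * G r s) * g q) \<in> I"
      by (rule diff_mem_trans[OF G[OF s] comb])
    from diff_mem_sym[OF this] have "(\<Sum>q<N. const_poly (?c q) * g q) \<in> I"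
      by (simp add: const_poly_simps left_diff_distrib sum_subtractf gs[unfolded const_poly_simps])
    then have "\<forall>q<N. ?c q = 0" by (rule indep)
    then have "?c q = 0" using q by blast
    then show "(?H * ?G) $$ (q, s) = 1\<^sub>m N $$ (q, s)"
      using q s by (simp add: scalar_prod_def lessThan_atLeast0)
  qed auto
  then have GH: "?G * ?H = 1\<^sub>m N" by (intro mat_mult_left_right_inverse[of ?H]) auto
  obtain e where e: "u - (\<Sum>r<N. const_poly (e r) * f r) \<in> I" using f u by (auto simp: basis_mod_def)
  have "h * (\<Sum>r<N. const_poly (e r) * f r) \<in> I"
    using diff_mem_iff[OF diff_mult_mem[OF e, of h]] hu by simp
  then have "(\<Sum>q<N. const_poly (\<Sum>r<N. H q r * e r) * g q) \<in> I"
    using diff_mem_iff[OF comb] by simp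
  from indep[OF this] have He: "(\<Sum>r<N. H q r * e r) = 0" if "q < N" for q
    using that by blast
  let ?e = "Matrix.vec N e"
  have "?H *\<^sub>v ?e = 0\<^sub>v N"
    using He by (intro eq_vecI) (auto simp: scalar_prod_def lessThan_atLeast0)
  moreover have "?G *\<^sub>v 0\<^sub>v N = 0\<^sub>v N"
    by (intro eq_vecI) (auto simp: scalar_prod_def)
  ultimately have "?e = 0\<^sub>v N"
    using assoc_mult_mat_vec[of ?G N N ?H N ?e] GH by simp
  then have "e r = 0" if "r < N" for r
    using that by (metis index_vec index_zero_vec(1))
  then have "(\<Sum>r<N. const_poly (e r) * f r) = 0" by (intro sum.neutral) (auto simp: const_poly_simps)
  with e show ?thesis by simp
qed

text \<open>Division by \<open>h\<close> from bidegree \<open>(a + 1, b)\<close> to \<open>(a, b)\<close>; well defined and linear modulo \<open>I\<close>.\<close>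

definition red :: "('x, 'y, 'k) bipoly \<Rightarrow> ('x, 'y, 'k) bipoly" where
  "red f = (SOME g. g \<in> bihom a b \<and> f - h * g \<in> I)"

lemma red:
  assumes "f \<in> bihom (Suc a) b"
  shows "red f \<in> bihom a b" "f - h * red f \<in> I"
proof -
  have "\<exists>g. g \<in> bihom a b \<and> f - h * g \<in> I" using h_surjective[of f 0] assms by auto
  from someI_ex[OF this] show "red f \<in> bihom a b" "f - h * red f \<in> I" by (simp_all add: red_def)
qed

lemma red_unique:
  assumes f: "f \<in> bihom (Suc a) b" and g: "g \<in> bihom a b" "f - h * g \<in> I"
  shows "red f - g \<in> I"
proof (rule h_injective)
  show "red f - g \<in> bihom a b" using red(1)[OF f] g(1) by (rule bihom_diff)
  have "h * red f - h * g \<in> I" using diff_mem_trans[OF diff_mem_sym[OF red(2)[OF f]] g(2)] .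
  then show "h * (red f - g) \<in> I" by (simp add: right_diff_distrib)
qed

lemma red_cong:
  assumes "f \<in> bihom (Suc a) b" "g \<in> bihom (Suc a) b" "f - g \<in> I"
  shows "red f - red g \<in> I"
  using red_unique[OF assms(1) red(1)[OF assms(2)] diff_mem_trans[OF assms(3) red(2)[OF assms(2)]]] .

lemma red_add:
  assumes "f \<in> bihom (Suc a) b" "g \<in> bihom (Suc a) b"
  shows "red (f + g) - (red f + red g) \<in> I"
proof (rule red_unique)
  show "f + g - h * (red f + red g) \<in> I"
    using add_mem[OF red(2)[OF assms(1)] red(2)[OF assms(2)]] by (simp add: algebra_simps)
qed (use assms in \<open>auto intro: bihom_add red\<close>)

lemma red_const_poly:
  assumes "f \<in> bihom (Suc a) b"
  shows "red (const_poly c * f) - const_poly c * red f \<in> I"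
proof (rule red_unique)
  show "const_poly c * f - h * (const_poly c * red f) \<in> I"
    using diff_mult_mem[OF red(2)[OF assms], of "const_poly c"] by (simp add: ac_simps)
qed (use assms in \<open>auto intro: bihom_const red\<close>)

lemma red_mult_h: "w \<in> bihom a b \<Longrightarrow> red (h * w) - w \<in> I"
  using bihom_mult_x[OF h_bihom, of w a b] by (intro red_unique) auto

lemma bihom_linear_mult: "u \<in> bihom 1 0 \<Longrightarrow> w \<in> bihom c d \<Longrightarrow> u * w \<in> bihom (Suc c) d"
  using bihom_mult_x[of u 1 w c d] by simp

text \<open>Elements of \<open>R\<^bsub>a,b\<^esub>\<close> themselves are divisible by \<open>h\<close>: with \<open>w = h w'\<close> modulo \<open>I\<close>, the inner
  reduction of \<open>v w\<close> is \<open>v w'\<close>, and both sides become the reduction of \<open>u v w'\<close>.\<close>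

lemma red_commute:
  assumes u: "u \<in> bihom 1 0" and v: "v \<in> bihom 1 0" and w: "w \<in> bihom a b"
  shows "red (u * red (v * w)) - red (v * red (u * w)) \<in> I"
proof -
  obtain w' where w': "w - h * w' \<in> I" "\<And>u. u \<in> bihom 1 0 \<Longrightarrow> u * w' \<in> bihom a b"
    by (rule divide_by_h[OF w]) blast
  have half: "red (u * red (v * w)) - red (u * (v * w')) \<in> I"
    if u: "u \<in> bihom 1 0" and v: "v \<in> bihom 1 0" for u v
  proof (rule red_cong)
    have "v * w - h * (v * w') \<in> I" using diff_mult_mem[OF w'(1), of v] by (simp add: ac_simps)
    then have "red (v * w) - v * w' \<in> I"
      by (intro red_unique bihom_linear_mult v w w'(2))
    then show "u * red (v * w) - u * (v * w') \<in> I" by (rule diff_mult_mem)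
  qed (intro bihom_linear_mult u v w red w'(2))+
  have "red (v * (u * w')) - red (v * red (u * w)) \<in> I"
    by (rule diff_mem_sym[OF half[OF v u]])
  moreover have "v * (u * w') = u * (v * w')" by (simp add: ac_simps)
  ultimately have "red (u * (v * w')) - red (v * red (u * w)) \<in> I" by (simp only:)
  with half[OF u v] show ?thesis by (rule diff_mem_trans)
qed

end

definition some_x :: "('x + 'y \<Rightarrow>\<^sub>0 nat) \<Rightarrow> 'x" where
  "some_x t = (SOME i. Poly_Mapping.lookup t (Inl i) \<noteq> 0)"

lemma some_x: "xdeg t > 0 \<Longrightarrow> Poly_Mapping.lookup t (Inl (some_x t)) \<noteq> 0"
  unfolding some_x_def by (rule someI_ex) (rule xdeg_pos)

abbreviation unit_x :: "'x \<Rightarrow> 'x + 'y \<Rightarrow>\<^sub>0 nat" where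
  "unit_x i \<equiv> Poly_Mapping.single (Inl i) 1"

lemma var_Inl_times_single: "var (Inl i) * Poly_Mapping.single t c = Poly_Mapping.single (t + unit_x i) c"
  by (simp add: var_def mult_single add.commute)

lemma sum_keys_add:
  fixes F :: "'a \<Rightarrow> 'b::comm_monoid_add \<Rightarrow> 'c::comm_monoid_add"
  assumes "\<And>t. F t 0 = 0" "\<And>t c d. F t (c + d) = F t c + F t d"
  shows "(\<Sum>t\<in>Poly_Mapping.keys (f + g). F t (Poly_Mapping.lookup (f + g) t)) =
    (\<Sum>t\<in>Poly_Mapping.keys f. F t (Poly_Mapping.lookup f t)) + (\<Sum>t\<in>Poly_Mapping.keys g. F t (Poly_Mapping.lookup g t))"
proof -
  let ?K = "Poly_Mapping.keys f \<union> Poly_Mapping.keys g"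
  have "(\<Sum>t\<in>Poly_Mapping.keys k. F t (Poly_Mapping.lookup k t)) = (\<Sum>t\<in>?K. F t (Poly_Mapping.lookup k t))"
    if "Poly_Mapping.keys k \<subseteq> ?K" for k
    using that by (intro sum.mono_neutral_left) (auto simp: in_keys_iff assms)
  from this[of "f + g"] this[of f] this[of g] show ?thesis
    using Poly_Mapping.keys_add[of f g] by (simp add: lookup_add assms sum.distrib)
qed

context admissible_bidegree
begin

text \<open>The normal form of a monomial of bidegree \<open>(a + d, b)\<close>, a polynomial of bidegree \<open>(a, b)\<close> that
  equals the monomial divided by \<open>h\<^sup>d\<close> modulo \<open>I\<close>. The variable to split off is chosen arbitrarily.\<close>

primrec nf_monomial :: "nat \<Rightarrow> ('x + 'y \<Rightarrow>\<^sub>0 nat) \<Rightarrow> ('x, 'y, 'k) bipoly" where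
  "nf_monomial 0 t = Poly_Mapping.single t 1"
| "nf_monomial (Suc d) t = red (var (Inl (some_x t)) * nf_monomial d (t - unit_x (some_x t)))"

lemma divide_out_some_x:
  assumes "xdeg t = Suc c"
  shows "t = (t - unit_x (some_x t)) + unit_x (some_x t)" "xdeg (t - unit_x (some_x t)) = c"
    "ydeg (t - unit_x (some_x t)) = ydeg t"
proof -
  show t: "t = (t - unit_x (some_x t)) + unit_x (some_x t)"
    using some_x[of t] assms by (intro divide_out_variable) auto
  from arg_cong[OF this, of xdeg] arg_cong[OF this, of ydeg] assms
  show "xdeg (t - unit_x (some_x t)) = c" "ydeg (t - unit_x (some_x t)) = ydeg t"
    by simp_all
qed

lemma nf_monomial_bihom: "xdeg t = a + d \<Longrightarrow> ydeg t = b \<Longrightarrow> nf_monomial d t \<in> bihom a b"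
proof (induction d arbitrary: t)
  case (Suc d)
  then have "var (Inl (some_x t)) * nf_monomial d (t - unit_x (some_x t)) \<in> bihom (Suc a) b"
    using divide_out_some_x[of t "a + d"] by (intro bihom_linear_mult bihom_var Suc.IH) simp_all
  then show ?case by (simp add: red)
qed (auto intro: bihom_single)

text \<open>Independence of the chosen variable. If \<open>x\<^sub>i\<close> is split off from \<open>x\<^sub>j t\<close> with \<open>i \<noteq> j\<close>, then
  \<open>t = x\<^sub>i u\<close>; by induction both sides arise from the normal form of \<open>u\<close> by splitting off \<open>x\<^sub>i\<close> and
  \<open>x\<^sub>j\<close>, in the two orders, and these reductions commute. For \<open>d = 0\<close> the two sides are reductions
  of the same monomial.\<close>

lemma nf_monomial_step:
  assumes "xdeg t = a + d" "ydeg t = b"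
  shows "nf_monomial (Suc d) (t + unit_x j) - red (var (Inl j) * nf_monomial d t) \<in> I"
  using assms
proof (induction d arbitrary: t j)
  case 0
  have "nf_monomial (Suc 0) (t + unit_x j) = red (Poly_Mapping.single (t + unit_x j) 1)"
    using divide_out_some_x(1)[of "t + unit_x j" a] 0 by (simp add: var_Inl_times_single)
  also have "\<dots> = red (var (Inl j) * nf_monomial 0 t)"
    by (simp add: var_Inl_times_single)
  finally show ?case by simp
next
  case (Suc d)
  let ?T = "t + unit_x j"
  define i where "i = some_x ?T"
  have T: "?T = (?T - unit_x i) + unit_x i" unfolding i_def using divide_out_some_x(1)[of ?T "a + Suc d"] Suc.prems by simp
  show ?case
  proof (cases "i = j")
    case True
    then show ?thesis by (simp add: i_def)
  next
    case False
    have "Poly_Mapping.lookup ?T (Inl i) \<noteq> 0" unfolding i_def using some_x[of ?T] Suc.prems by simp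
    then have "Poly_Mapping.lookup t (Inl i) \<noteq> 0"
      using False by (auto simp: lookup_add lookup_single when_def)
    define u where "u = t - unit_x i"
    have t: "t = u + unit_x i" unfolding u_def by (rule divide_out_variable) fact
    have u: "xdeg u = a + d" "ydeg u = b" using arg_cong[OF t, of xdeg] arg_cong[OF t, of ydeg] Suc.prems by auto
    have "(?T - unit_x i) + unit_x i = (u + unit_x j) + unit_x i"
      using T t by (metis add.assoc add.commute)
    then have T': "?T - unit_x i = u + unit_x j" by (rule add_right_imp_eq)
    define w where "w = nf_monomial d u"
    have w: "w \<in> bihom a b" unfolding w_def by (rule nf_monomial_bihom) fact+
    let ?xi = "var (Inl i) :: ('x, 'y, 'k) bipoly" and ?xj = "var (Inl j) :: ('x, 'y, 'k) bipoly"
    have x: "?xi \<in> bihom 1 0" "?xj \<in> bihom 1 0" by (rule bihom_var)+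
    have nf: "nf_monomial (Suc d) t \<in> bihom a b" "nf_monomial (Suc d) (u + unit_x j) \<in> bihom a b"
      using nf_monomial_bihom[of t "Suc d"] nf_monomial_bihom[of "u + unit_x j" "Suc d"] Suc.prems u
      by (simp_all del: nf_monomial.simps)
    have 1: "red (?xi * nf_monomial (Suc d) (u + unit_x j)) - red (?xi * red (?xj * w)) \<in> I"
      using Suc.IH[OF u, of j] unfolding w_def[symmetric]
      by (intro red_cong bihom_linear_mult x red w diff_mult_mem nf)
    have 2: "red (?xj * nf_monomial (Suc d) t) - red (?xj * red (?xi * w)) \<in> I"
      using Suc.IH[OF u, of i] unfolding w_def[symmetric] t[symmetric]
      by (intro red_cong bihom_linear_mult x red w diff_mult_mem nf)
    have "nf_monomial (Suc (Suc d)) ?T = red (?xi * nf_monomial (Suc d) (u + unit_x j))"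
      unfolding T'[symmetric] i_def by (rule nf_monomial.simps(2))
    then show ?thesis
      using diff_mem_trans[OF diff_mem_trans[OF 1 red_commute[OF x w]] diff_mem_sym[OF 2]] by simp
  qed
qed

definition nf :: "nat \<Rightarrow> ('x, 'y, 'k) bipoly \<Rightarrow> ('x, 'y, 'k) bipoly" where
  "nf d f = (\<Sum>t\<in>Poly_Mapping.keys f. const_poly (Poly_Mapping.lookup f t) * nf_monomial d t)"

lemma nf_add: "nf d (f + g) = nf d f + nf d g"
  unfolding nf_def by (rule sum_keys_add) (auto simp: const_poly_simps distrib_right)

lemma nf_zero [simp]: "nf d 0 = 0"
  by (simp add: nf_def)

lemma nf_single: "nf d (Poly_Mapping.single t c) = const_poly c * nf_monomial d t"
  by (cases "c = 0") (auto simp: nf_def const_poly_simps)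

lemma nf_0: "nf 0 f = f"
  by (simp add: nf_def const_poly_times_single poly_mapping_eq_sum_single[symmetric])

lemma nf_bihom: "f \<in> bihom (a + d) b \<Longrightarrow> nf d f \<in> bihom a b"
  unfolding nf_def by (intro bihom_sum bihom_const nf_monomial_bihom) (auto simp: bihom_def)

lemma nf_var:
  assumes "f \<in> bihom (a + d) b"
  shows "nf (Suc d) (var (Inl j) * f) - red (var (Inl j) * nf d f) \<in> I"
proof -
  let ?x = "var (Inl j) :: ('x, 'y, 'k) bipoly"
  have x: "?x \<in> bihom 1 0" by (rule bihom_var)
  have "f \<in> bihom (a + d) b \<and> nf (Suc d) (?x * f) - red (?x * nf d f) \<in> I"
  proof (induction f rule: additive_induct)
    case zero
    have "red 0 - 0 \<in> I" by (rule red_unique) auto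
    from uminus_mem[OF this] show ?case by simp
  next
    case (add f g)
    then have "red (?x * nf d f + ?x * nf d g) - (red (?x * nf d f) + red (?x * nf d g)) \<in> I"
      by (intro red_add bihom_linear_mult x nf_bihom) auto
    from diff_mem[OF add_mem[OF conjunct2[OF add(1)] conjunct2[OF add(2)]] this]
    show ?case using add by (auto simp: distrib_left nf_add algebra_simps intro: bihom_add)
  next
    case (single t)
    define c where "c = Poly_Mapping.lookup f t"
    have t: "xdeg t = a + d" "ydeg t = b" using assms single by (auto simp: bihom_def)
    note n = nf_monomial_bihom[OF t]
    have 1: "nf (Suc d) (?x * Poly_Mapping.single t c) = const_poly c * nf_monomial (Suc d) (t + unit_x j)"
      unfolding var_Inl_times_single nf_single ..
    have 2: "const_poly c * nf_monomial (Suc d) (t + unit_x j) - const_poly c * red (?x * nf_monomial d t) \<in> I"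
      by (rule diff_mult_mem[OF nf_monomial_step[OF t]])
    have "red (?x * nf d (Poly_Mapping.single t c)) - const_poly c * red (?x * nf_monomial d t) \<in> I"
      using red_const_poly[OF bihom_linear_mult[OF x n], of c] by (simp add: nf_single ac_simps)
    from diff_mem_trans[OF 2 diff_mem_sym[OF this]] show ?case unfolding c_def[symmetric] 1
      using bihom_single[OF t] by blast
  qed
  then show ?thesis by blast
qed

lemma nf_linear_form:
  assumes f: "f \<in> bihom (a + d) b" and u: "u \<in> bihom 1 0"
  shows "nf (Suc d) (u * f) - red (u * nf d f) \<in> I"
proof -
  note n = nf_bihom[OF f]
  have "u \<in> bihom 1 0 \<and> nf (Suc d) (u * f) - red (u * nf d f) \<in> I"
  proof (induction u rule: additive_induct)
    case zero
    have "red 0 - 0 \<in> I" by (rule red_unique) auto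
    from uminus_mem[OF this] show ?case by simp
  next
    case (add u v)
    then have "red (u * nf d f + v * nf d f) - (red (u * nf d f) + red (v * nf d f)) \<in> I"
      by (intro red_add bihom_linear_mult n) auto
    from diff_mem[OF add_mem[OF conjunct2[OF add(1)] conjunct2[OF add(2)]] this]
    show ?case using add by (auto simp: distrib_right nf_add algebra_simps intro: bihom_add)
  next
    case (single t)
    define c where "c = Poly_Mapping.lookup u t"
    have t: "xdeg t = Suc 0" "ydeg t = 0" using u single by (auto simp: bihom_def)
    define i where "i = some_x t"
    have "xdeg (t - unit_x i) = 0" "ydeg (t - unit_x i) = 0" and t': "t = (t - unit_x i) + unit_x i"
      unfolding i_def using divide_out_some_x[OF t(1)] t(2) by auto
    then have "Poly_Mapping.lookup (t - unit_x i) v = 0" for v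
      unfolding xdeg_def ydeg_def by (cases v) auto
    then have "t - unit_x i = 0" by (intro poly_mapping_eqI) simp
    with t' have "t = unit_x i" by simp
    then have s: "Poly_Mapping.single t c * g = var (Inl i) * (const_poly c * g)" for g
      by (simp add: var_def const_poly_def mult_single mult.assoc[symmetric])
    have cf: "const_poly c * f \<in> bihom (a + d) b" using f by (rule bihom_const)
    have "nf d (const_poly c * f) = const_poly c * nf d f"
    proof (induction f rule: additive_induct)
      case (single t)
      then show ?case by (simp add: const_poly_times_single nf_single const_poly_simps ac_simps)
    qed (auto simp: distrib_left nf_add)
    with nf_var[OF cf, of i] show ?case
      unfolding c_def[symmetric] s using t by (auto intro: bihom_single)
  qed
  then show ?thesis by blast
qed

text \<open>Above \<open>x\<close>-degree \<open>a\<close> every monomial multiple of a generator involves a further \<open>x\<close>-variable,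
  because the generator has \<open>x\<close>-degree at most \<open>a\<close>. So it is \<open>x\<^sub>i\<close> times an element of \<open>I\<close> of
  \<open>x\<close>-degree one less, and induction applies.\<close>

lemma nf_mem: "f \<in> I \<Longrightarrow> f \<in> bihom (a + d) b \<Longrightarrow> nf d f \<in> I"
proof (induction d arbitrary: f)
  case 0
  then show ?case by (simp add: nf_0)
next
  case (Suc d)
  obtain S where S: "\<And>s. s \<in> S \<Longrightarrow> \<exists>a' b'. a' \<le> a \<and> b' \<le> b \<and> s \<in> bihom a' b'" and I: "I = genideal class_ring S"
    using generated unfolding generated_upto_def by auto
  have SI: "S \<subseteq> I" unfolding I by (rule ring.genideal_self[OF class_ring.ring_axioms]) auto
  have "f \<in> genideal class_ring S" using Suc.prems(1) by (simp only: I[symmetric])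
  then have "nf (Suc d) (bicomponent (a + Suc d) b f) \<in> I"
  proof (induction f rule: genideal_induct)
    case zero
    then show ?case by (simp add: bicomponent_0 nf_zero)
  next
    case (add f g)
    then show ?case using add_mem by (simp add: bicomponent_add nf_add)
  next
    case (single s t c)
    then obtain a' b' where s: "a' \<le> a" "s \<in> bihom a' b'" using S by blast
    let ?m = "Poly_Mapping.single t c * s"
    have m: "?m \<in> bihom (xdeg t + a') (ydeg t + b')" using s(2) by (intro bihom_mult bihom_single) auto
    show ?case
    proof (cases "xdeg t + a' = a + Suc d \<and> ydeg t + b' = b")
      case True
      then obtain e where e: "xdeg t = Suc e" using s(1) by (cases "xdeg t") auto
      let ?t = "t - unit_x (some_x t)"
      let ?m' = "Poly_Mapping.single ?t c * s"
      note t = divide_out_some_x[OF e]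
      have mm: "?m = var (Inl (some_x t)) * ?m'"
        by (subst t(1)) (simp add: mult.assoc[symmetric] var_Inl_times_single)
      have m': "?m' \<in> bihom (a + d) b"
        using bihom_mult[OF bihom_single[OF t(2,3)] s(2), of c] True e by (simp add: algebra_simps)
      have "?m' \<in> I" using single SI by (auto intro: mult_mem)
      then have "nf d ?m' \<in> I" using Suc.IH m' by blast
      then have "var (Inl (some_x t)) * nf d ?m' - h * 0 \<in> I" by (auto intro: mult_mem)
      then have "red (var (Inl (some_x t)) * nf d ?m') - 0 \<in> I"
        by (intro red_unique bihom_linear_mult bihom_var nf_bihom m') auto
      from diff_mem_trans[OF nf_var[OF m'] this] have "nf (Suc d) ?m \<in> I" by (simp add: mm)
      then show ?thesis unfolding bicomponent_of_bihom[OF m] using True by simp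
    next
      case False
      then show ?thesis unfolding bicomponent_of_bihom[OF m] by auto
    qed
  qed
  then show ?case using Suc.prems(2) by (simp add: bicomponent_of_bihom)
qed

lemma nf_h_power: "g \<in> bihom a b \<Longrightarrow> nf d (h ^ d * g) - g \<in> I"
proof (induction d)
  case (Suc d)
  have f: "h ^ d * g \<in> bihom (a + d) b" using Suc.prems by (intro bihom_mult_x bihom_power h_bihom)
  have "nf (Suc d) (h * (h ^ d * g)) - nf d (h ^ d * g) \<in> I"
    by (rule diff_mem_trans[OF nf_linear_form[OF f h_bihom] red_mult_h[OF nf_bihom[OF f]]])
  from diff_mem_trans[OF this Suc.IH[OF Suc.prems]] show ?case by (simp add: ac_simps)
qed (simp add: nf_0)

text \<open>The map \<open>nf d\<close> sends \<open>h\<^sup>d g\<close> to \<open>g\<close> and \<open>I\<close> to \<open>I\<close>, modulo \<open>I\<close>.\<close>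

lemma h_power_injective:
  assumes "g \<in> bihom a b" "h ^ d * g \<in> I"
  shows "g \<in> I"
proof -
  have "nf d (h ^ d * g) \<in> I" using assms by (intro nf_mem bihom_mult_x bihom_power h_bihom)
  then show ?thesis using diff_mem_iff[OF nf_h_power[OF assms(1)]] by blast
qed

lemma h_power_surjective: "f \<in> bihom (a + d) b \<Longrightarrow> \<exists>g\<in>bihom a b. f - h ^ d * g \<in> I"
proof (induction d arbitrary: f)
  case 0
  then show ?case by (intro bexI[of _ f]) auto
next
  case (Suc d)
  then obtain f' where f': "f' \<in> bihom (a + d) b" "f - h * f' \<in> I" using h_surjective[of f d] by auto
  then obtain g where g: "g \<in> bihom a b" "f' - h ^ d * g \<in> I" using Suc.IH by blast
  from diff_mem_trans[OF f'(2) diff_mult_mem[OF g(2)]] g(1) show ?case by (auto simp: ac_simps)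
qed

end

section \<open>Evaluation, projective points and the ideal of the projection\<close>

definition evalX_monomial :: "('x::finite \<Rightarrow> 'k alg_closure) \<Rightarrow> ('x + 'y \<Rightarrow>\<^sub>0 nat) \<Rightarrow> 'k::field alg_closure" where
  "evalX_monomial v t = (\<Prod>i\<in>UNIV. v i ^ Poly_Mapping.lookup t (Inl i))"

lemma evalX_monomial_add: "evalX_monomial v (s + t) = evalX_monomial v s * evalX_monomial v t"
  by (simp add: evalX_monomial_def lookup_add power_add prod.distrib)

lemma evalX_monomial_scale: "evalX_monomial (\<lambda>i. c * v i) t = c ^ xdeg t * evalX_monomial v t"
  by (simp add: evalX_monomial_def xdeg_def power_mult_distrib prod.distrib power_sum)

lemma evalX_single: "evalX v (Poly_Mapping.single t c) = to_ac c * evalX_monomial v t"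
  by (cases "c = 0") (auto simp: evalX_def evalX_monomial_def)

lemma evalX_0 [simp]: "evalX v 0 = 0"
  by (simp add: evalX_def)

lemma evalX_add: "evalX v (f + g) = evalX v f + evalX v g"
  unfolding evalX_def by (rule sum_keys_add) (auto simp: distrib_right)

text \<open>Although meant for polynomials in the \<open>x\<close>-variables, this evaluation is a ring homomorphism on all
  of \<open>R\<close>: it substitutes \<open>1\<close> for the \<open>y\<close>-variables.\<close>

lemma evalX_mult: "evalX v (f * g) = evalX v f * evalX v g"
proof (induction f rule: additive_induct)
  case (single t)
  show ?case
  proof (induction g rule: additive_induct)
    case (single u)
    show ?case by (simp add: mult_single evalX_single evalX_monomial_add)
  qed (auto simp: distrib_left evalX_add)
qed (auto simp: distrib_right evalX_add)

lemma evalX_1 [simp]: "evalX v 1 = 1"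
  using evalX_single[of v 0 1] by (simp add: evalX_monomial_def)

lemma evalX_power: "evalX v (f ^ d) = evalX v f ^ d"
  by (induction d) (auto simp: evalX_mult)

lemma evalX_const_poly: "evalX v (const_poly c) = to_ac c"
  unfolding const_poly_def evalX_single by (simp add: evalX_monomial_def)

lemma evalX_sum: "evalX v (sum f A) = (\<Sum>i\<in>A. evalX v (f i))"
  by (induction A rule: infinite_finite_induct) (auto simp: evalX_add)

lemma evalX_var: "evalX v (var (Inl i)) = v i"
proof -
  have "evalX_monomial v (unit_x i) = (\<Prod>j\<in>UNIV. if j = i then v j else 1)"
    unfolding evalX_monomial_def by (intro prod.cong) (auto simp: lookup_single when_def)
  then show ?thesis by (simp add: var_def evalX_single)
qed

lemma evalX_scale:
  assumes "f \<in> bihom d b"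
  shows "evalX (\<lambda>i. c * v i) f = c ^ d * evalX v f"
  using assms unfolding evalX_def evalX_monomial_def[symmetric] evalX_monomial_scale
  by (auto simp: bihom_def sum_distrib_left ac_simps intro!: sum.cong)

definition proj_point :: "('x::finite \<Rightarrow> 'k::field alg_closure) \<Rightarrow> ('x, 'k) proj_point" where
  "proj_point v = {w. \<exists>c. c \<noteq> 0 \<and> w = (\<lambda>i. c * v i)}"

lemma proj_space_eq: "proj_space = proj_point ` {v. v \<noteq> (\<lambda>_. 0)}"
  unfolding proj_space_def proj_point_def quotient_def by (auto simp: image_def)

lemma mem_proj_point: "v \<in> proj_point v"
  unfolding proj_point_def by (auto intro: exI[of _ 1])

lemma proj_point_scale:
  assumes "c \<noteq> 0"
  shows "proj_point (\<lambda>i. c * v i) = proj_point v"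
proof -
  have "\<exists>e. e \<noteq> 0 \<and> (\<lambda>i. d * v i) = (\<lambda>i. e * (c * v i))" if "d \<noteq> 0" for d
    using assms that by (intro exI[of _ "d / c"]) (auto simp: field_simps)
  moreover have "\<exists>e. e \<noteq> 0 \<and> (\<lambda>i. d * (c * v i)) = (\<lambda>i. e * v i)" if "d \<noteq> 0" for d
    using assms that by (intro exI[of _ "d * c"]) (auto simp: field_simps)
  ultimately show ?thesis unfolding proj_point_def by blast
qed

lemma single_mem_power_ideal_y:
  fixes t :: "'x::finite + 'y::finite \<Rightarrow>\<^sub>0 nat"
  assumes "xdeg t = 0" "ydeg t = b"
  shows "Poly_Mapping.single t 1 \<in> (ideal_y :: ('x, 'y, 'k::field) bipoly set) [^]\<^bsub>ideals_set class_ring\<^esub> b"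
  using assms
proof (induction b arbitrary: t)
  case 0
  then show ?case by (simp add: ideals_set_def)
next
  case (Suc b)
  then obtain j where j: "Poly_Mapping.lookup t (Inr j) \<noteq> 0" using ydeg_pos[of t] by auto
  let ?u = "Poly_Mapping.single (Inr j) 1 :: 'x + 'y \<Rightarrow>\<^sub>0 nat"
  have t: "t = (t - ?u) + ?u" by (rule divide_out_variable[OF j])
  from arg_cong[OF t, of xdeg] arg_cong[OF t, of ydeg] Suc.prems
  have d: "xdeg (t - ?u) = 0" "ydeg (t - ?u) = b" by auto
  have "(var (Inr j) :: ('x, 'y, 'k) bipoly) \<in> ideal_y"
    unfolding ideal_y_def by (rule subsetD[OF ring.genideal_self[OF class_ring.ring_axioms]]) auto
  from ideal_prod.prod[OF Suc.IH[OF d] this, of class_ring]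
  have "Poly_Mapping.single (t - ?u) 1 * var (Inr j)
      \<in> (ideal_y :: ('x, 'y, 'k) bipoly set) [^]\<^bsub>ideals_set class_ring\<^esub> Suc b"
    by (simp add: ideals_set_def)
  also have "Poly_Mapping.single (t - ?u) 1 * var (Inr j) = (Poly_Mapping.single t 1 :: ('x, 'y, 'k) bipoly)"
    by (subst (2) t) (simp add: var_def mult_single)
  finally show ?case .
qed

lemma keys_ideal_y:
  assumes "f \<in> ideal_y" "t \<in> Poly_Mapping.keys f"
  shows "1 \<le> ydeg t"
proof -
  have "\<forall>t\<in>Poly_Mapping.keys f. 1 \<le> ydeg t"
    using assms(1) unfolding ideal_y_def
  proof (induction f rule: genideal_induct)
    case (add f g)
    then show ?case using Poly_Mapping.keys_add[of f g] by blast
  next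
    case (single s t c)
    then obtain j where "s = var (Inr j)" by auto
    then show ?case using Poly_Mapping.keys_single[of "t + Poly_Mapping.single (Inr j) 1" c]
      by (auto simp: var_def mult_single split: if_splits)
  qed auto
  with assms(2) show ?thesis by blast
qed

lemma keys_power_ideal_y:
  fixes f :: "('x::finite, 'y::finite, 'k::field) bipoly"
  assumes "f \<in> ideal_y [^]\<^bsub>ideals_set class_ring\<^esub> b" "t \<in> Poly_Mapping.keys f"
  shows "b \<le> ydeg t"
  using assms
proof (induction b arbitrary: f t)
  case (Suc b)
  have "f \<in> ideal_prod class_ring (ideal_y [^]\<^bsub>ideals_set class_ring\<^esub> b) ideal_y"
    using Suc.prems(1) by (simp add: ideals_set_def)
  then have "\<forall>t\<in>Poly_Mapping.keys f. Suc b \<le> ydeg t"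
  proof (induction f rule: ideal_prod.induct)
    case (prod i j)
    show ?case
    proof
      fix t assume "t \<in> Poly_Mapping.keys (i \<otimes>\<^bsub>class_ring\<^esub> j)"
      then obtain u w where "t = u + w" "u \<in> Poly_Mapping.keys i" "w \<in> Poly_Mapping.keys j"
        using Poly_Mapping.keys_mult[of i j] by auto
      with Suc.IH[OF prod(1)] keys_ideal_y[OF prod(2)] show "Suc b \<le> ydeg t" by fastforce
    qed
  next
    case (sum f g)
    then show ?case using Poly_Mapping.keys_add[of f g] by auto
  qed
  with Suc.prems(2) show ?case by blast
qed simp

lemma bihom_subset_RX: "bihom d 0 \<subseteq> RX"
  unfolding bihom_def RX_def ydeg_def by auto

context admissible_bidegree
begin

text \<open>A monomial of bidegree \<open>(a, b)\<close> is a multiple of a monomial of degree \<open>b\<close> in the \<open>y\<close>-variables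
  alone, and the latter lies in the \<open>b\<close>-th power of the ideal of the \<open>y\<close>-variables.\<close>

lemma J_ideal_component_annihilates:
  assumes f: "f \<in> J_ideal I b" and g: "g \<in> bihom a b"
  shows "bicomponent d 0 f * g \<in> I"
proof (induction g rule: additive_induct)
  case (single t)
  have t: "xdeg t = a" "ydeg t = b + 0" using g single by (auto simp: bihom_def)
  obtain t1 t2 where s: "t = t1 + t2" "ydeg t1 = b" "xdeg t1 = 0"
    using power_product_split_y[OF t(2)] by auto
  let ?m = "Poly_Mapping.single t1 1 :: ('x, 'y, 'k) bipoly"
  have "f * ?m \<in> I"
    using f single_mem_power_ideal_y[OF s(3,2)] unfolding J_ideal_def colon_def by blast
  then have "bicomponent d b (?m * f) \<in> I" by (intro bicomponent_mem) (simp add: mult.commute)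
  then have "?m * bicomponent d 0 f \<in> I"
    using bicomponent_mult[OF bihom_single[OF s(3,2)], of d b 1 f] by simp
  then have "Poly_Mapping.single t2 (Poly_Mapping.lookup g t) * (?m * bicomponent d 0 f) \<in> I" by (rule mult_mem)
  moreover have "Poly_Mapping.single t (Poly_Mapping.lookup g t)
      = Poly_Mapping.single t2 (Poly_Mapping.lookup g t) * ?m"
    by (simp add: s mult_single add.commute)
  ultimately show ?case by (simp only: ac_simps)
qed (auto simp: distrib_left intro: add_mem)

text \<open>A monomial in the \<open>b\<close>-th power of the ideal of the \<open>y\<close>-variables is a multiple of some \<open>y\<close>-monomial
  of degree \<open>b\<close>, and \<open>x\<^sub>i\<^sup>a\<close> times that one has bidegree \<open>(a, b)\<close>.\<close>

lemma annihilator_times_power_in_J_ideal: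
  assumes F: "F \<in> bihom d 0" and ann: "\<And>g. g \<in> bihom a b \<Longrightarrow> F * g \<in> I"
  shows "F * var (Inl i) ^ a \<in> J_ideal I b"
proof -
  let ?x = "var (Inl i) ^ a :: ('x, 'y, 'k) bipoly"
  have x: "?x \<in> bihom a 0" by (intro bihom_power bihom_var)
  have "F * ?x \<in> RX" using bihom_mult[OF F x] bihom_subset_RX by auto
  moreover have "F * ?x * g \<in> I" if g: "g \<in> ideal_y [^]\<^bsub>ideals_set class_ring\<^esub> b" for g
  proof (induction g rule: additive_induct)
    case (single t)
    then have "b \<le> ydeg t" using keys_power_ideal_y[OF g] by blast
    then have "ydeg t = b + (ydeg t - b)" by simp
    from power_product_split_y[OF this] obtain t1 t2 where s: "t = t1 + t2" "ydeg t1 = b" "xdeg t1 = 0" by auto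
    let ?m = "Poly_Mapping.single t1 1 :: ('x, 'y, 'k) bipoly"
    let ?m2 = "Poly_Mapping.single t2 (Poly_Mapping.lookup g t)"
    have "?m * ?x \<in> bihom a b" using bihom_mult[OF bihom_single[OF s(3,2)] x, of 1] by simp
    then have "?m2 * (F * (?m * ?x)) \<in> I" by (intro mult_mem ann)
    moreover have "Poly_Mapping.single t (Poly_Mapping.lookup g t) = ?m2 * ?m"
      by (simp add: s mult_single add.commute)
    ultimately show ?case by (simp only: ac_simps)
  qed (auto simp: distrib_left intro: add_mem)
  ultimately show ?thesis unfolding J_ideal_def colon_def by blast
qed

end

section \<open>Matrices of multiplication maps\<close>

text \<open>The set \<open>U\<close> is the graph of a \<open>k\<close>-linear map into the algebraic closure, defined on a subspace of
  \<open>k\<^sup>S\<close>; such a map extends to \<open>k\<^sup>S\<close> and is then given by coefficients. The proof eliminates one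
  coordinate at a time.\<close>

lemma linear_functional_extension:
  fixes U :: "(('i \<Rightarrow> 'k::field) \<times> 'k alg_closure) set"
  assumes "finite S"
    and "\<And>B C x y. (B, x) \<in> U \<Longrightarrow> (C, y) \<in> U \<Longrightarrow> ((\<lambda>i. B i + C i), x + y) \<in> U"
    and "\<And>B x c. (B, x) \<in> U \<Longrightarrow> ((\<lambda>i. c * B i), to_ac c * x) \<in> U"
    and "\<And>B x. (B, x) \<in> U \<Longrightarrow> (\<And>i. i \<in> S \<Longrightarrow> B i = 0) \<Longrightarrow> x = 0"
  shows "\<exists>l. \<forall>(B, x)\<in>U. x = (\<Sum>i\<in>S. to_ac (B i) * l i)"
  using assms
proof (induction S arbitrary: U rule: finite_induct)
  case empty
  then show ?case by auto
next
  case (insert k S)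
  let ?U = "{(B, x) \<in> U. B k = 0}"
  have "\<exists>l. \<forall>(B, x)\<in>?U. x = (\<Sum>i\<in>S. to_ac (B i) * l i)"
  proof (rule insert.IH)
    fix B x assume "(B, x) \<in> ?U" "\<And>i. i \<in> S \<Longrightarrow> B i = 0"
    then show "x = 0" using insert.prems(3)[of B x] by auto
  qed (use insert.prems in auto)
  then obtain l where l: "\<And>B x. (B, x) \<in> U \<Longrightarrow> B k = 0 \<Longrightarrow> x = (\<Sum>i\<in>S. to_ac (B i) * l i)" by auto
  show ?case
  proof (cases "\<exists>B x. (B, x) \<in> U \<and> B k \<noteq> 0")
    case False
    then have "x = (\<Sum>i\<in>insert k S. to_ac (B i) * l i)" if "(B, x) \<in> U" for B x
      using l[OF that] that insert.hyps by auto
    then show ?thesis by auto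
  next
    case True
    then obtain B1 x1 where 1: "(B1, x1) \<in> U" "B1 k \<noteq> 0" by blast
    define B0 x0 where "B0 = (\<lambda>i. inverse (B1 k) * B1 i)" and "x0 = to_ac (inverse (B1 k)) * x1"
    have 0: "(B0, x0) \<in> U" "B0 k = 1"
      unfolding B0_def x0_def by (rule insert.prems(2)[OF 1(1)]) (use 1(2) in simp)
    define l' where "l' = l(k := x0 - (\<Sum>i\<in>S. to_ac (B0 i) * l i))"
    have l': "(\<Sum>i\<in>S. to_ac (B i) * l' i) = (\<Sum>i\<in>S. to_ac (B i) * l i)" for B
      using insert.hyps by (intro sum.cong) (auto simp: l'_def)
    have "x = (\<Sum>i\<in>insert k S. to_ac (B i) * l' i)" if B: "(B, x) \<in> U" for B x
    proof -
      have "((\<lambda>i. B i + - B k * B0 i), x + to_ac (- B k) * x0) \<in> U"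
        by (intro insert.prems(1) B insert.prems(2) 0)
      from l[OF this] have "x - to_ac (B k) * x0
          = (\<Sum>i\<in>S. to_ac (B i) * l i) - to_ac (B k) * (\<Sum>i\<in>S. to_ac (B0 i) * l i)"
        using 0(2) by (simp add: left_diff_distrib sum_subtractf sum_distrib_left mult.assoc)
      then show ?thesis using insert.hyps
        by (simp add: l') (simp add: l'_def algebra_simps)
    qed
    then show ?thesis by auto
  qed
qed

locale admissible_basis = admissible_bidegree I a b h
  for I :: "('x::finite, 'y::finite, 'k::field) bipoly set" and a b h +
  fixes N :: nat and f :: "nat \<Rightarrow> ('x, 'y, 'k) bipoly"
  assumes basis: "basis_mod a b N f"
begin

definition comb :: "(nat \<Rightarrow> 'k) \<Rightarrow> ('x, 'y, 'k) bipoly" where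
  "comb e = (\<Sum>r<N. const_poly (e r) * f r)"

lemma f_bihom: "r < N \<Longrightarrow> f r \<in> bihom a b"
  using basis by (simp add: basis_mod_def)

lemma comb_bihom: "comb e \<in> bihom a b"
  unfolding comb_def by (intro bihom_sum bihom_const f_bihom) auto

lemma comb_diff: "comb e - comb e' = comb (\<lambda>r. e r - e' r)"
  by (simp add: comb_def const_poly_simps left_diff_distrib sum_subtractf)

lemma comb_cong: "(\<And>r. r < N \<Longrightarrow> e r = e' r) \<Longrightarrow> comb e = comb e'"
  by (simp add: comb_def)

lemma comb_unit: "s < N \<Longrightarrow> comb (\<lambda>r. if r = s then 1 else 0) = f s"
proof -
  assume s: "s < N"
  have "comb (\<lambda>r. if r = s then 1 else 0) = (\<Sum>r<N. if r = s then f r else 0)"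
    unfolding comb_def by (intro sum.cong) (auto simp: const_poly_simps)
  with s show ?thesis by simp
qed

lemma comb_exists: "g \<in> bihom a b \<Longrightarrow> \<exists>e. g - comb e \<in> I"
  using basis by (simp add: basis_mod_def comb_def)

lemma comb_independent: "comb e \<in> I \<Longrightarrow> r < N \<Longrightarrow> e r = 0"
  using basis unfolding basis_mod_def comb_def by metis

lemma coords_unique:
  assumes "g - h ^ d * comb e \<in> I" "g - h ^ d * comb e' \<in> I" "r < N"
  shows "e r = e' r"
proof -
  have "h ^ d * comb (\<lambda>r. e r - e' r) \<in> I"
    using diff_mem_trans[OF diff_mem_sym[OF assms(1)] assms(2)]
    by (simp add: comb_diff[symmetric] right_diff_distrib)
  then have "comb (\<lambda>r. e r - e' r) \<in> I" using h_power_injective[OF comb_bihom] by blast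
  from comb_independent[OF this assms(3)] show ?thesis by simp
qed

definition coords :: "nat \<Rightarrow> ('x, 'y, 'k) bipoly \<Rightarrow> nat \<Rightarrow> 'k" where
  "coords d g = (SOME e. g - h ^ d * comb e \<in> I)"

lemma coords:
  assumes "g \<in> bihom (a + d) b"
  shows "g - h ^ d * comb (coords d g) \<in> I"
proof -
  obtain g' where g': "g' \<in> bihom a b" "g - h ^ d * g' \<in> I" using h_power_surjective[OF assms] by blast
  obtain e where "g' - comb e \<in> I" using comb_exists[OF g'(1)] by blast
  from diff_mem_trans[OF g'(2) diff_mult_mem[OF this]]
  have "\<exists>e. g - h ^ d * comb e \<in> I" by blast
  then show ?thesis unfolding coords_def by (rule someI_ex)
qed

text \<open>The matrix of \<open>h\<^bsup>-d\<^esup> F\<close> on \<open>(R/I)\<^bsub>a,b\<^esub>\<close> in the given basis, for \<open>F\<close> of bidegree \<open>(d, 0)\<close>.\<close>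

definition mult_mat :: "nat \<Rightarrow> ('x, 'y, 'k) bipoly \<Rightarrow> 'k mat" where
  "mult_mat d F = Matrix.mat N N (\<lambda>(r, s). coords d (F * f s) r)"

lemma mult_mat_carrier [simp]: "mult_mat d F \<in> carrier_mat N N"
  by (simp add: mult_mat_def)

lemma mult_mat_dim [simp]: "dim_row (mult_mat d F) = N" "dim_col (mult_mat d F) = N"
  by (simp_all add: mult_mat_def)

lemma mult_mat:
  assumes "F \<in> bihom d 0" "s < N"
  shows "F * f s - h ^ d * comb (\<lambda>r. mult_mat d F $$ (r, s)) \<in> I"
proof -
  have "comb (\<lambda>r. mult_mat d F $$ (r, s)) = comb (coords d (F * f s))"
    using assms(2) by (intro comb_cong) (simp add: mult_mat_def)
  then show ?thesis using coords[OF bihom_mult_x[OF assms(1) f_bihom[OF assms(2)]]] by simp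
qed

lemma mult_mat_unique:
  assumes "F \<in> bihom d 0" "M \<in> carrier_mat N N"
    and "\<And>s. s < N \<Longrightarrow> F * f s - h ^ d * comb (\<lambda>r. M $$ (r, s)) \<in> I"
  shows "mult_mat d F = M"
proof (rule eq_matI)
  fix r s assume "r < dim_row M" "s < dim_col M"
  then have "r < N" "s < N" using assms(2) by auto
  then show "mult_mat d F $$ (r, s) = M $$ (r, s)"
    using coords_unique[OF mult_mat[OF assms(1)] assms(3)] by blast
qed (use assms(2) in auto)

lemma mult_mat_comb:
  assumes F: "F \<in> bihom d 0"
  shows "F * comb e - h ^ d * comb (\<lambda>r. \<Sum>s<N. mult_mat d F $$ (r, s) * e s) \<in> I"
  unfolding comb_def
  by (rule linear_combination_image) (use mult_mat[OF F] in \<open>simp add: comb_def\<close>)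

lemma mult_mat_add:
  assumes "F \<in> bihom d 0" "G \<in> bihom d 0"
  shows "mult_mat d (F + G) = mult_mat d F + mult_mat d G"
proof (rule mult_mat_unique)
  fix s assume s: "s < N"
  have "comb (\<lambda>r. (mult_mat d F + mult_mat d G) $$ (r, s))
      = comb (\<lambda>r. mult_mat d F $$ (r, s)) + comb (\<lambda>r. mult_mat d G $$ (r, s))"
    using s by (simp add: comb_def const_poly_simps distrib_right sum.distrib)
  then show "(F + G) * f s - h ^ d * comb (\<lambda>r. (mult_mat d F + mult_mat d G) $$ (r, s)) \<in> I"
    using add_mem[OF mult_mat[OF assms(1) s] mult_mat[OF assms(2) s]] by (simp add: algebra_simps)
qed (use assms in \<open>auto intro: bihom_add\<close>)

lemma mult_mat_const_poly:
  assumes "F \<in> bihom d 0"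
  shows "mult_mat d (const_poly c * F) = c \<cdot>\<^sub>m mult_mat d F"
proof (rule mult_mat_unique)
  fix s assume s: "s < N"
  have "comb (\<lambda>r. (c \<cdot>\<^sub>m mult_mat d F) $$ (r, s)) = const_poly c * comb (\<lambda>r. mult_mat d F $$ (r, s))"
    using s by (simp add: comb_def const_poly_simps sum_distrib_left mult.assoc)
  then show "const_poly c * F * f s - h ^ d * comb (\<lambda>r. (c \<cdot>\<^sub>m mult_mat d F) $$ (r, s)) \<in> I"
    using diff_mult_mem[OF mult_mat[OF assms s], of "const_poly c"] by (simp add: ac_simps)
qed (use assms in \<open>auto intro: bihom_const\<close>)

text \<open>Modulo \<open>I\<close>, \<open>F G f\<^sub>s\<close> is \<open>h\<^sup>e\<close> times \<open>F\<close> applied to the combination in column \<open>s\<close> of the matrix of \<open>G\<close>,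
  and \<open>F\<close> acts on combinations by its matrix.\<close>

lemma mult_mat_mult:
  assumes F: "F \<in> bihom d 0" and G: "G \<in> bihom e 0"
  shows "mult_mat (d + e) (F * G) = mult_mat d F * mult_mat e G"
proof (rule mult_mat_unique)
  fix s assume s: "s < N"
  let ?c = "\<lambda>r. mult_mat e G $$ (r, s)"
  have "F * (G * f s) - F * (h ^ e * comb ?c) \<in> I"
    by (rule diff_mult_mem[OF mult_mat[OF G s]])
  then have 1: "F * G * f s - h ^ e * (F * comb ?c) \<in> I" by (simp add: ac_simps)
  have "h ^ e * (F * comb ?c) - h ^ e * (h ^ d * comb (\<lambda>r. \<Sum>q<N. mult_mat d F $$ (r, q) * ?c q)) \<in> I"
    by (rule diff_mult_mem[OF mult_mat_comb[OF F]])
  from diff_mem_trans[OF 1 this]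
  have "F * G * f s - h ^ (d + e) * comb (\<lambda>r. \<Sum>q<N. mult_mat d F $$ (r, q) * ?c q) \<in> I"
    by (simp add: power_add ac_simps)
  also have "comb (\<lambda>r. \<Sum>q<N. mult_mat d F $$ (r, q) * ?c q) = comb (\<lambda>r. (mult_mat d F * mult_mat e G) $$ (r, s))"
    using s by (intro comb_cong) (simp add: scalar_prod_def lessThan_atLeast0)
  finally show "F * G * f s - h ^ (d + e) * comb (\<lambda>r. (mult_mat d F * mult_mat e G) $$ (r, s)) \<in> I" .
next
  show "F * G \<in> bihom (d + e) 0" using bihom_mult[OF F G] by simp
  show "mult_mat d F * mult_mat e G \<in> carrier_mat N N"
    by (rule mult_carrier_mat[OF mult_mat_carrier mult_mat_carrier])
qed

lemma comb_unit_column: "s < N \<Longrightarrow> comb (\<lambda>r. 1\<^sub>m N $$ (r, s)) = f s"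
  unfolding comb_unit[symmetric] by (intro comb_cong) auto

lemma mult_mat_h: "mult_mat 1 h = 1\<^sub>m N"
  by (rule mult_mat_unique[OF h_bihom]) (auto simp: comb_unit_column)

lemma mult_mat_1: "mult_mat 0 1 = 1\<^sub>m N"
  by (rule mult_mat_unique) (auto simp: comb_unit_column)

lemma mult_mat_eq_0_iff:
  assumes F: "F \<in> bihom d 0"
  shows "mult_mat d F = 0\<^sub>m N N \<longleftrightarrow> (\<forall>g\<in>bihom a b. F * g \<in> I)" (is "_ \<longleftrightarrow> ?ann")
proof
  assume 0: "mult_mat d F = 0\<^sub>m N N"
  show ?ann
  proof
    fix g :: "('x, 'y, 'k) bipoly" assume "g \<in> bihom a b"
    then obtain e where e: "g - comb e \<in> I" using comb_exists by metis
    have "comb (\<lambda>r. \<Sum>s<N. mult_mat d F $$ (r, s) * e s) = comb (\<lambda>_. 0)"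
      by (intro comb_cong) (simp add: 0)
    also have "\<dots> = 0" by (simp add: comb_def const_poly_simps)
    finally have "F * comb e \<in> I" using mult_mat_comb[OF F, of e] by simp
    then show "F * g \<in> I" using diff_mem_iff[OF diff_mult_mem[OF e]] by blast
  qed
next
  assume ann: ?ann
  show "mult_mat d F = 0\<^sub>m N N"
  proof (rule mult_mat_unique[OF F])
    fix s assume s: "s < N"
    have "comb (\<lambda>r. 0\<^sub>m N N $$ (r, s)) = comb (\<lambda>_. 0)" using s by (intro comb_cong) simp
    also have "\<dots> = 0" by (simp add: comb_def const_poly_simps)
    finally show "F * f s - h ^ d * comb (\<lambda>r. 0\<^sub>m N N $$ (r, s)) \<in> I"
      using ann f_bihom[OF s] by simp
  qed simp
qed

end

section \<open>Points as joint eigenvalues\<close>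

interpretation to_ac: comm_ring_hom to_ac
  by unfold_locales auto

definition triangular_with_diag :: "nat \<Rightarrow> 'a::semiring_1 mat \<Rightarrow> (nat \<Rightarrow> 'a) \<Rightarrow> bool" where
  "triangular_with_diag n T x \<longleftrightarrow> T \<in> carrier_mat n n \<and> upper_triangular T \<and> (\<forall>j<n. T $$ (j, j) = x j)"

lemma triangular_with_diag_add:
  "triangular_with_diag n S x \<Longrightarrow> triangular_with_diag n T y \<Longrightarrow> triangular_with_diag n (S + T) (\<lambda>j. x j + y j)"
  unfolding triangular_with_diag_def upper_triangular_def by auto

lemma triangular_with_diag_smult:
  "triangular_with_diag n T x \<Longrightarrow> triangular_with_diag n (c \<cdot>\<^sub>m T) (\<lambda>j. c * x j)"
  unfolding triangular_with_diag_def upper_triangular_def by auto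

text \<open>Taking the \<open>j\<close>-th diagonal entry is a ring homomorphism on upper triangular matrices.\<close>

lemma triangular_with_diag_mult:
  assumes S: "triangular_with_diag n S x" and T: "triangular_with_diag n T y"
  shows "triangular_with_diag n (S * T) (\<lambda>j. x j * y j)"
proof -
  have carr: "S \<in> carrier_mat n n" "T \<in> carrier_mat n n" using S T by (auto simp: triangular_with_diag_def)
  have entry: "(S * T) $$ (i, j) = (\<Sum>k<n. S $$ (i, k) * T $$ (k, j))" if "i < n" "j < n" for i j
    using that carr by (simp add: scalar_prod_def lessThan_atLeast0)
  have zero: "S $$ (i, k) * T $$ (k, j) = 0" if "i < n" "j < n" "k < n" "k < i \<or> j < k" for i j k
    using that S T carr unfolding triangular_with_diag_def upper_triangular_def by auto
  have "(S * T) $$ (j, j) = x j * y j" if "j < n" for j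
  proof -
    have "(S * T) $$ (j, j) = (\<Sum>k<n. if k = j then x j * y j else 0)"
      unfolding entry[OF that that]
      using S T that zero[OF that that] by (intro sum.cong) (auto simp: triangular_with_diag_def neq_iff)
    then show ?thesis using that by simp
  qed
  moreover have "(S * T) $$ (i, j) = 0" if "i < n" "j < i" for i j
    unfolding entry[OF that(1) less_trans[OF that(2,1)]]
    using that by (intro sum.neutral ballI zero) auto
  ultimately show ?thesis
    using carr by (auto simp: triangular_with_diag_def upper_triangular_def)
qed

locale triangularized_basis = admissible_basis I a b h N f
  for I :: "('x::finite, 'y::finite, 'k::field) bipoly set" and a b h N f +
  fixes P Q :: "'k alg_closure mat"
  assumes PQ: "P \<in> carrier_mat N N" "Q \<in> carrier_mat N N" "P * Q = 1\<^sub>m N" "Q * P = 1\<^sub>m N"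
    and triangular: "\<And>i. upper_triangular (P * map_mat to_ac (mult_mat 1 (var (Inl i))) * Q)"
begin

definition tri :: "nat \<Rightarrow> ('x, 'y, 'k) bipoly \<Rightarrow> 'k alg_closure mat" where
  "tri d F = P * map_mat to_ac (mult_mat d F) * Q"

text \<open>The joint eigenvalue of the variables at diagonal position \<open>j\<close>, a vector of homogeneous coordinates.\<close>

definition point :: "nat \<Rightarrow> 'x \<Rightarrow> 'k alg_closure" where
  "point j i = tri 1 (var (Inl i)) $$ (j, j)"

lemma ac_carrier: "map_mat to_ac (mult_mat d F) \<in> carrier_mat N N"
  by simp

lemma tri_carrier: "tri d F \<in> carrier_mat N N"
  unfolding tri_def using PQ by (intro mult_carrier_mat[of _ N N]) auto

lemma conjugate_add:
  assumes "A \<in> carrier_mat N N" "B \<in> carrier_mat N N"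
  shows "P * (A + B) * Q = P * A * Q + P * B * Q"
proof -
  have "P * (A + B) = P * A + P * B" by (rule mult_add_distrib_mat[OF PQ(1) assms])
  then show ?thesis
    using add_mult_distrib_mat[of "P * A" N N "P * B" Q N] PQ assms by auto
qed

lemma conjugate_smult:
  assumes "A \<in> carrier_mat N N"
  shows "P * (c \<cdot>\<^sub>m A) * Q = c \<cdot>\<^sub>m (P * A * Q)"
proof -
  have "P * (c \<cdot>\<^sub>m A) = c \<cdot>\<^sub>m (P * A)" by (rule mult_smult_distrib[OF PQ(1) assms])
  then show ?thesis using mult_smult_assoc_mat[of "P * A" N N Q N c] PQ assms by auto
qed

lemma tri_add:
  "F \<in> bihom d 0 \<Longrightarrow> G \<in> bihom d 0 \<Longrightarrow> tri d (F + G) = tri d F + tri d G"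
proof -
  assume "F \<in> bihom d 0" "G \<in> bihom d 0"
  moreover have "map_mat to_ac (mult_mat d F + mult_mat d G)
      = map_mat to_ac (mult_mat d F) + map_mat to_ac (mult_mat d G)"
    by (intro eq_matI) auto
  ultimately show ?thesis unfolding tri_def by (simp add: mult_mat_add conjugate_add)
qed

lemma tri_const_poly:
  "F \<in> bihom d 0 \<Longrightarrow> tri d (const_poly c * F) = to_ac c \<cdot>\<^sub>m tri d F"
proof -
  assume "F \<in> bihom d 0"
  moreover have "map_mat to_ac (c \<cdot>\<^sub>m mult_mat d F) = to_ac c \<cdot>\<^sub>m map_mat to_ac (mult_mat d F)"
    by (intro eq_matI) auto
  ultimately show ?thesis unfolding tri_def by (simp add: mult_mat_const_poly conjugate_smult)
qed

lemma tri_mult: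
  assumes "F \<in> bihom d 0" "G \<in> bihom e 0"
  shows "tri (d + e) (F * G) = tri d F * tri e G"
proof -
  have "map_mat to_ac (mult_mat (d + e) (F * G)) = map_mat to_ac (mult_mat d F) * map_mat to_ac (mult_mat e G)"
    unfolding mult_mat_mult[OF assms] by (rule to_ac.mat_hom_mult[OF mult_mat_carrier mult_mat_carrier])
  then show ?thesis
    unfolding tri_def conjugate_mult[OF ac_carrier ac_carrier PQ(1,2,4)] by simp
qed

lemma tri_1: "tri 0 1 = 1\<^sub>m N" and tri_h: "tri 1 h = 1\<^sub>m N"
  unfolding tri_def mult_mat_1 mult_mat_h using PQ by (simp_all add: to_ac.mat_hom_one)

lemma tri_triangular_monomial:
  assumes "xdeg t = d" "ydeg t = 0"
  shows "triangular_with_diag N (tri d (Poly_Mapping.single t 1)) (\<lambda>j. evalX (point j) (Poly_Mapping.single t 1))"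
  using assms
proof (induction d arbitrary: t)
  case 0
  then have "Poly_Mapping.lookup t v = 0" for v
    unfolding xdeg_def ydeg_def by (cases v) auto
  then have "t = 0" by (intro poly_mapping_eqI) simp
  then show ?case by (auto simp: tri_1 triangular_with_diag_def upper_triangular_def)
next
  case (Suc d)
  let ?u = "t - unit_x (some_x t)" and ?x = "var (Inl (some_x t)) :: ('x, 'y, 'k) bipoly"
  note t = divide_out_some_x[OF Suc.prems(1)]
  have m: "Poly_Mapping.single ?u 1 \<in> bihom d 0" using t Suc.prems by (intro bihom_single) auto
  have s: "Poly_Mapping.single t 1 = ?x * Poly_Mapping.single ?u 1"
    by (subst t(1)) (simp add: var_Inl_times_single)
  have "triangular_with_diag N (tri 1 ?x) (\<lambda>j. evalX (point j) ?x)"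
    using triangular[of "some_x t"] tri_carrier
    by (simp add: triangular_with_diag_def evalX_var point_def tri_def)
  from triangular_with_diag_mult[OF this Suc.IH[OF t(2)]] t(3) Suc.prems(2)
  show ?case using tri_mult[OF bihom_var m, of "some_x t"] by (simp add: s evalX_mult)
qed

text \<open>Both conditions pass to sums, scalar multiples and products, and they hold for the variables.\<close>

lemma tri_triangular:
  assumes F: "F \<in> bihom d 0"
  shows "triangular_with_diag N (tri d F) (\<lambda>j. evalX (point j) F)"
proof -
  have "F \<in> bihom d 0 \<and> triangular_with_diag N (tri d F) (\<lambda>j. evalX (point j) F)"
  proof (induction F rule: additive_induct)
    case zero
    have "tri d (const_poly 0 * 0) = to_ac 0 \<cdot>\<^sub>m tri d 0" by (rule tri_const_poly) simp
    then have "tri d 0 = to_ac 0 \<cdot>\<^sub>m tri d 0" by simp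
    also have "\<dots> = 0\<^sub>m N N" using tri_carrier[of d 0] by (intro eq_matI) auto
    finally have "tri d 0 = 0\<^sub>m N N" .
    then show ?case by (auto simp: triangular_with_diag_def upper_triangular_def)
  next
    case (add F G)
    then show ?case
      using triangular_with_diag_add by (auto simp: tri_add evalX_add intro: bihom_add)
  next
    case (single t)
    define c where "c = Poly_Mapping.lookup F t"
    have t: "xdeg t = d" "ydeg t = 0" using F single by (auto simp: bihom_def)
    have s: "Poly_Mapping.single t c = const_poly c * Poly_Mapping.single t 1"
      by (simp add: const_poly_times_single)
    have "triangular_with_diag N (to_ac c \<cdot>\<^sub>m tri d (Poly_Mapping.single t 1))
        (\<lambda>j. to_ac c * evalX (point j) (Poly_Mapping.single t 1))"
      by (rule triangular_with_diag_smult[OF tri_triangular_monomial[OF t]])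
    moreover have m: "Poly_Mapping.single t 1 \<in> bihom d 0" by (rule bihom_single[OF t])
    ultimately show ?case
      unfolding c_def[symmetric] s tri_const_poly[OF m] evalX_mult evalX_const_poly
      using bihom_const[OF m] by blast
  qed
  then show ?thesis by blast
qed

lemma point_h: "j < N \<Longrightarrow> evalX (point j) h = 1"
  using tri_triangular[OF h_bihom] unfolding tri_h triangular_with_diag_def by auto

lemma point_nonzero: "j < N \<Longrightarrow> point j \<noteq> (\<lambda>_. 0)"
  using point_h[of j] evalX_scale[OF h_bihom, of 0 "point j"] by auto

text \<open>Each homogeneous component of \<open>F\<close> annihilates \<open>(R/I)\<^bsub>a,b\<^esub>\<close>, so its matrix is zero and with it the
  diagonal entry, which is its value at the point.\<close>

lemma point_vanishes:
  assumes j: "j < N" and F: "F \<in> J_ideal I b"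
  shows "evalX (\<lambda>i. c * point j i) F = 0"
proof -
  let ?D = "(\<lambda>t. (xdeg t, ydeg t)) ` Poly_Mapping.keys F"
  have "evalX (\<lambda>i. c * point j i) (bicomponent d e F) = 0" if de: "(d, e) \<in> ?D" for d e
  proof -
    have "e = 0" using F de by (auto simp: J_ideal_def RX_def ydeg_def)
    have B: "bicomponent d 0 F \<in> bihom d 0" by (rule bicomponent_bihom)
    have "mult_mat d (bicomponent d 0 F) = 0\<^sub>m N N"
      unfolding mult_mat_eq_0_iff[OF B] using J_ideal_component_annihilates[OF F] by blast
    then have "map_mat to_ac (mult_mat d (bicomponent d 0 F)) = 0\<^sub>m N N" by (intro eq_matI) auto
    then have "tri d (bicomponent d 0 F) = 0\<^sub>m N N"
      unfolding tri_def using PQ by simp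
    then have "evalX (point j) (bicomponent d 0 F) = 0"
      using tri_triangular[OF B] j by (auto simp: triangular_with_diag_def)
    then show ?thesis unfolding \<open>e = 0\<close> evalX_scale[OF B] by simp
  qed
  then have "evalX (\<lambda>i. c * point j i) (\<Sum>(d, e)\<in>?D. bicomponent d e F) = 0"
    unfolding evalX_sum by (intro sum.neutral) auto
  then show ?thesis using bicomponent_sum[of F] by simp
qed

lemma proj_point_mem: "j < N \<Longrightarrow> proj_point (point j) \<in> proj_pts I b"
  unfolding proj_pts_def vanishing_set_def proj_space_eq
  using point_nonzero point_vanishes by (auto simp: proj_point_def)

text \<open>The \<open>K\<close>-linear combinations of forms of degree \<open>d\<close> over \<open>k\<close>, each recorded only by its matrix and
  its value at \<open>v\<close>. This stands for forms with coefficients in the algebraic closure \<open>K\<close>.\<close>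

inductive evaluation_pair :: "('x \<Rightarrow> 'k alg_closure) \<Rightarrow> nat \<Rightarrow> 'k alg_closure mat \<Rightarrow> 'k alg_closure \<Rightarrow> bool"
  for v where
  base: "F \<in> bihom d 0 \<Longrightarrow> evaluation_pair v d (map_mat to_ac (mult_mat d F)) (evalX v F)"
| add: "evaluation_pair v d B x \<Longrightarrow> evaluation_pair v d C y \<Longrightarrow> evaluation_pair v d (B + C) (x + y)"
| smult: "evaluation_pair v d B x \<Longrightarrow> evaluation_pair v d (c \<cdot>\<^sub>m B) (c * x)"

lemma evaluation_pair_carrier: "evaluation_pair v d B x \<Longrightarrow> B \<in> carrier_mat N N"
  by (induction rule: evaluation_pair.induct) auto

text \<open>Multiplication of a form by the linear form \<open>x\<^sub>i + c h\<close>.\<close>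

lemma evaluation_pair_times_linear:
  assumes "evaluation_pair v d B x"
  shows "evaluation_pair v (Suc d) (B * (map_mat to_ac (mult_mat 1 (var (Inl i))) + c \<cdot>\<^sub>m 1\<^sub>m N))
    (x * (v i + c * evalX v h))"
  using assms
proof (induction rule: evaluation_pair.induct)
  case (base F d)
  let ?A = "map_mat to_ac (mult_mat d F)" and ?X = "map_mat to_ac (mult_mat 1 (var (Inl i)))"
  have deg: "F * var (Inl i) \<in> bihom (Suc d) 0" "F * h \<in> bihom (Suc d) 0"
    using bihom_mult[OF base bihom_var] bihom_mult[OF base h_bihom] by auto
  have 1: "evaluation_pair v (Suc d) (?A * ?X) (evalX v F * v i)"
    using evaluation_pair.base[OF deg(1), of v]
    using mult_mat_mult[OF base bihom_var, of i] to_ac.mat_hom_mult[OF mult_mat_carrier mult_mat_carrier]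
    by (simp add: evalX_mult evalX_var)
  have 2: "evaluation_pair v (Suc d) ?A (evalX v F * evalX v h)"
    using evaluation_pair.base[OF deg(2), of v]
      mult_mat_mult[OF base h_bihom] by (simp add: evalX_mult mult_mat_h[unfolded One_nat_def])
  have "?A * (?X + c \<cdot>\<^sub>m 1\<^sub>m N) = ?A * ?X + c \<cdot>\<^sub>m ?A"
    by (subst mult_add_distrib_mat[of _ N N _ N]) (auto simp: mult_smult_distrib[of _ N N _ N])
  with evaluation_pair.add[OF 1 evaluation_pair.smult[OF 2, of c]]
  show ?case by (simp add: algebra_simps)
next
  case (add d B x C y)
  have "(B + C) * (map_mat to_ac (mult_mat 1 (var (Inl i))) + c \<cdot>\<^sub>m 1\<^sub>m N)
      = B * (map_mat to_ac (mult_mat 1 (var (Inl i))) + c \<cdot>\<^sub>m 1\<^sub>m N)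
      + C * (map_mat to_ac (mult_mat 1 (var (Inl i))) + c \<cdot>\<^sub>m 1\<^sub>m N)"
    using add.hyps by (intro add_mult_distrib_mat[of _ N N]) (auto dest: evaluation_pair_carrier)
  with evaluation_pair.add[OF add.IH] show ?case by (simp add: distrib_right)
next
  case (smult d B x e)
  have "(e \<cdot>\<^sub>m B) * (map_mat to_ac (mult_mat 1 (var (Inl i))) + c \<cdot>\<^sub>m 1\<^sub>m N)
      = e \<cdot>\<^sub>m (B * (map_mat to_ac (mult_mat 1 (var (Inl i))) + c \<cdot>\<^sub>m 1\<^sub>m N))"
    using smult.hyps by (intro mult_smult_assoc_mat[of _ N N]) (auto dest: evaluation_pair_carrier)
  with evaluation_pair.smult[OF smult.IH, of e] show ?case by (simp add: mult.assoc)
qed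

text \<open>Let \<open>F\<close> have coefficients in \<open>k\<close>. If its matrix is zero, then \<open>F x\<^sub>i\<^sup>a \<in> J\<^sub>b\<close> for all \<open>i\<close>, so
  \<open>F(v) v\<^sub>i\<^sup>a = 0\<close>, and \<open>F(v) = 0\<close> since some \<open>v\<^sub>i\<close> is nonzero. Hence the value at \<open>v\<close> is a fixed linear
  function of the entries of the matrix, and this relation extends to all evaluation pairs.\<close>

lemma evaluation_pair_zero:
  assumes v: "v \<noteq> (\<lambda>_. 0)" and J: "\<And>F. F \<in> J_ideal I b \<Longrightarrow> evalX v F = 0"
    and pair: "evaluation_pair v d (0\<^sub>m N N) x"
  shows "x = 0"
proof -
  let ?S = "{..<N} \<times> {..<N}"
  let ?U = "(\<lambda>F. (\<lambda>p. mult_mat d F $$ p when p \<in> ?S, evalX v F)) ` bihom d 0"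
  have "\<exists>l. \<forall>(B, x)\<in>?U. x = (\<Sum>p\<in>?S. to_ac (B p) * l p)"
  proof (rule linear_functional_extension)
    fix B C x y assume "(B, x) \<in> ?U" "(C, y) \<in> ?U"
    then obtain F G where F: "F \<in> bihom d 0" "G \<in> bihom d 0" "x = evalX v F" "y = evalX v G"
      "B = (\<lambda>p. mult_mat d F $$ p when p \<in> ?S)" "C = (\<lambda>p. mult_mat d G $$ p when p \<in> ?S)" by auto
    have "(\<lambda>p. B p + C p) = (\<lambda>p. mult_mat d (F + G) $$ p when p \<in> ?S)"
      using F by (auto simp: mult_mat_add when_def)
    then show "(\<lambda>p. B p + C p, x + y) \<in> ?U"
      using F bihom_add[OF F(1,2)] by (intro image_eqI[of _ _ "F + G"]) (auto simp: evalX_add)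
  next
    fix B x c assume "(B, x) \<in> ?U"
    then obtain F where F: "F \<in> bihom d 0" "x = evalX v F" "B = (\<lambda>p. mult_mat d F $$ p when p \<in> ?S)" by auto
    have "(\<lambda>p. c * B p) = (\<lambda>p. mult_mat d (const_poly c * F) $$ p when p \<in> ?S)"
      using F by (auto simp: mult_mat_const_poly when_def)
    then show "(\<lambda>p. c * B p, to_ac c * x) \<in> ?U"
      using F bihom_const[OF F(1), of c]
      by (intro image_eqI[of _ _ "const_poly c * F"]) (auto simp: evalX_mult evalX_const_poly)
  next
    fix B x assume "(B, x) \<in> ?U" and 0: "\<And>p. p \<in> ?S \<Longrightarrow> B p = 0"
    then obtain F where F: "F \<in> bihom d 0" "x = evalX v F" "B = (\<lambda>p. mult_mat d F $$ p when p \<in> ?S)" by auto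
    have "mult_mat d F = 0\<^sub>m N N" using 0 F(3) by (intro eq_matI) auto
    then have "F * var (Inl i) ^ a \<in> J_ideal I b" for i
      unfolding mult_mat_eq_0_iff[OF F(1)] by (intro annihilator_times_power_in_J_ideal[OF F(1)]) auto
    from J[OF this] have "x * v i ^ a = 0" for i by (simp add: F evalX_mult evalX_power evalX_var)
    with v show "x = 0" by (auto simp: fun_eq_iff)
  qed simp
  then obtain l where l0: "\<forall>(B, x)\<in>?U. x = (\<Sum>p\<in>?S. to_ac (B p) * l p)" ..
  have l: "x = (\<Sum>p\<in>?S. to_ac (B p) * l p)" if "(B, x) \<in> ?U" for B x
    using bspec[OF l0 that] by (simp only: prod.case)
  have functional: "y = (\<Sum>p\<in>?S. B $$ p * l p)" if "evaluation_pair v d' B y" "d' = d" for d' B y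
    using that
  proof (induction rule: evaluation_pair.induct)
    case (base F d')
    then have "(\<lambda>p. mult_mat d F $$ p when p \<in> ?S, evalX v F) \<in> ?U" by blast
    from l[OF this] show ?case using base.prems by (auto intro!: sum.cong)
  next
    case (add d' B x C y)
    then have "dim_row C = N" "dim_col C = N" by (auto dest!: evaluation_pair_carrier)
    then have "(\<Sum>p\<in>?S. (B + C) $$ p * l p) = (\<Sum>p\<in>?S. B $$ p * l p + C $$ p * l p)"
      by (intro sum.cong) (auto simp: distrib_right)
    with add show ?case by (simp add: sum.distrib)
  next
    case (smult d' B x c)
    then have "dim_row B = N" "dim_col B = N" by (auto dest!: evaluation_pair_carrier)
    then have "(\<Sum>p\<in>?S. (c \<cdot>\<^sub>m B) $$ p * l p) = (\<Sum>p\<in>?S. c * (B $$ p * l p))"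
      by (intro sum.cong) (auto simp: mult.assoc)
    with smult show ?case by (simp add: sum_distrib_left)
  qed
  from functional[OF pair refl] show ?thesis by (auto intro!: sum.neutral)
qed

text \<open>Otherwise each \<open>j\<close> has a coordinate \<open>k j\<close> in which \<open>v\<close> differs from \<open>h(v)\<close> times the \<open>j\<close>-th point.
  The product of the linear forms \<open>x\<^bsub>k j\<^esub> - c\<^sub>j h\<close>, with \<open>c\<^sub>j\<close> that coordinate of the \<open>j\<close>-th point, then
  has matrix zero but a nonzero value at \<open>v\<close>. Since \<open>v \<noteq> 0\<close>, the equation \<open>v = h(v) p\<^sub>j\<close> obtained
  here also gives \<open>h(v) \<noteq> 0\<close>.\<close>

lemma proj_pts_point:
  assumes "\<xi> \<in> proj_pts I b"
  shows "\<exists>j<N. \<xi> = proj_point (point j)"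
proof -
  obtain v where v: "v \<noteq> (\<lambda>_. 0)" "\<xi> = proj_point v" and J: "\<And>F. F \<in> J_ideal I b \<Longrightarrow> evalX v F = 0"
    using assms mem_proj_point unfolding proj_pts_def vanishing_set_def proj_space_eq by blast
  have "\<exists>j<N. v = (\<lambda>i. evalX v h * point j i)"
  proof (rule ccontr)
    assume "\<not> ?thesis"
    then have "\<forall>j. \<exists>i. j < N \<longrightarrow> v i \<noteq> evalX v h * point j i" by (auto simp: fun_eq_iff)
    from choice[OF this] obtain k where k: "\<And>j. j < N \<Longrightarrow> v (k j) \<noteq> evalX v h * point j (k j)" by blast
    \<comment> \<open>The matrix of the \<open>j\<close>-th linear form; after conjugation its \<open>j\<close>-th diagonal entry is zero.\<close>
    define T where "T j = map_mat to_ac (mult_mat 1 (var (Inl (k j)))) + (- point j (k j)) \<cdot>\<^sub>m 1\<^sub>m N" for j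
    have T: "T j \<in> carrier_mat N N" for j by (simp add: T_def)
    let ?y = "\<lambda>n. \<Prod>j<n. v (k j) + (- point j (k j)) * evalX v h"
    have pair: "evaluation_pair v n (mat_prod N T n) (?y n)" for n
    proof (induction n)
      case 0
      show ?case using evaluation_pair.base[of 1 0 v] by (simp add: mult_mat_1 to_ac.mat_hom_one)
    next
      case (Suc n)
      from evaluation_pair_times_linear[OF this, of "k n" "- point n (k n)"]
      show ?case by (simp add: T_def mult.commute)
    qed
    have T_tri: "P * T j * Q = tri 1 (var (Inl (k j))) + (- point j (k j)) \<cdot>\<^sub>m 1\<^sub>m N" for j
      unfolding T_def tri_def using PQ by (simp add: conjugate_add conjugate_smult)
    have "mat_prod N (\<lambda>j. P * T j * Q) N = 0\<^sub>m N N"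
    proof (rule mat_prod_triangular_zero)
      fix j assume j: "j < N"
      note x = tri_triangular[OF bihom_var, of "k j"]
      show "P * T j * Q \<in> carrier_mat N N" using T[of j] PQ by (intro mult_carrier_mat[of _ N N]) auto
      show "upper_triangular (P * T j * Q)" "(P * T j * Q) $$ (j, j) = 0"
        unfolding T_tri using x j by (auto simp: triangular_with_diag_def upper_triangular_def evalX_var)
    qed
    then have "P * mat_prod N T N * Q = 0\<^sub>m N N"
      using mat_prod_conjugate[OF PQ, of N T] T by simp
    moreover have W: "mat_prod N T N \<in> carrier_mat N N" using T by (intro mat_prod_carrier)
    then have "mat_prod N T N = Q * (P * mat_prod N T N * Q) * P"
      using PQ by (simp add: assoc_mult_mat[of _ N N _ N _ N])
        (simp add: assoc_mult_mat[of _ N N _ N _ N, symmetric])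
    ultimately have "mat_prod N T N = 0\<^sub>m N N" using PQ by simp
    then have "?y N = 0" using evaluation_pair_zero[OF v(1) J] pair[of N] by simp
    then show False using k by (auto simp: prod_zero_iff mult.commute)
  qed
  then obtain j where j: "j < N" "v = (\<lambda>i. evalX v h * point j i)" by blast
  have "evalX v h \<noteq> 0" using j(2) v(1) by auto
  then have "proj_point (\<lambda>i. evalX v h * point j i) = proj_point (point j)" by (rule proj_point_scale)
  then show ?thesis using j v(2) by auto
qed

lemma proj_pts_eq: "proj_pts I b = (\<lambda>j. proj_point (point j)) ` {..<N}"
  using proj_pts_point proj_point_mem by blast

lemma char_poly_mult_mat:
  assumes F: "F \<in> bihom d 0"
  shows "map_poly to_ac (char_poly (mult_mat d F)) = (\<Prod>j<N. [: - evalX (point j) F, 1 :])"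
proof -
  note t = tri_triangular[OF F]
  have "similar_mat (tri d F) (map_mat to_ac (mult_mat d F))"
    by (rule similar_matI[of _ _ P Q N]) (use PQ tri_carrier in \<open>auto simp: tri_def\<close>)
  from char_poly_similar[OF this]
  have "map_poly to_ac (char_poly (mult_mat d F)) = char_poly (tri d F)"
    using to_ac.char_poly_hom[OF mult_mat_carrier] by simp
  also have "\<dots> = (\<Prod>x\<leftarrow>diag_mat (tri d F). [: - x, 1 :])"
    using t by (intro char_poly_upper_triangular[of _ N]) (auto simp: triangular_with_diag_def)
  also have "diag_mat (tri d F) = map (\<lambda>j. evalX (point j) F) [0..<N]"
    using t by (auto simp: diag_mat_def triangular_with_diag_def)
  also have "(\<Prod>x\<leftarrow>map (\<lambda>j. evalX (point j) F) [0..<N]. [: - x, 1 :]) = (\<Prod>j<N. [: - evalX (point j) F, 1 :])"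
    by (simp add: comp_def prod.distinct_set_conv_list[symmetric] lessThan_atLeast0)
  finally show ?thesis .
qed

end

section \<open>The characteristic polynomial\<close>

lemma (in admissible_basis) triangularization_exists:
  "\<exists>P Q. triangularized_basis I a b h N f P Q"
proof -
  let ?A = "\<lambda>i. map_mat to_ac (mult_mat 1 (var (Inl i)))"
  have comm: "?A i * ?A j = ?A j * ?A i" for i j
  proof -
    have "mult_mat 1 (var (Inl i)) * mult_mat 1 (var (Inl j)) = mult_mat 1 (var (Inl j)) * mult_mat 1 (var (Inl i))"
      using mult_mat_mult[OF bihom_var bihom_var, of i j] mult_mat_mult[OF bihom_var bihom_var, of j i]
      by (simp add: mult.commute)
    then show ?thesis
      using to_ac.mat_hom_mult[OF mult_mat_carrier mult_mat_carrier] by metis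
  qed
  obtain P Q where "P \<in> carrier_mat N N" "Q \<in> carrier_mat N N" "P * Q = 1\<^sub>m N" "Q * P = 1\<^sub>m N"
    "\<And>i. upper_triangular (P * ?A i * Q)"
    using simultaneous_triangularization[of UNIV ?A N] comm by auto
  then have "triangularized_basis I a b h N f P Q"
    by unfold_locales auto
  then show ?thesis by blast
qed

text \<open>The inverse function in the definition of the multiplication map is meaningful because \<open>h\<^sup>d\<close> is
  injective on \<open>(R/I)\<^bsub>a,b\<^esub>\<close> and \<open>w\<close> witnesses that \<open>g u\<close> lies in its image.\<close>

lemma (in admissible_bidegree) mult_map_residue_class:
  assumes q: "fraction_rep h q = (g, d)" and u: "u \<in> bihom a b" and w: "w \<in> bihom a b"
    and gu: "g * u - h ^ d * w \<in> I"
  shows "mult_map I a b h q (residue_class I u) = residue_class I w"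
proof -
  have "inv_into (carrier (quot_comp I a b)) (quot_mult I (h ^ d)) (quot_mult I g (residue_class I u))
      = residue_class I w"
  proof (rule inv_into_f_eq)
    show "inj_on (quot_mult I (h ^ d)) (carrier (quot_comp I a b))"
    proof (rule inj_onI)
      fix x y assume "x \<in> carrier (quot_comp I a b)" "y \<in> carrier (quot_comp I a b)"
        and eq: "quot_mult I (h ^ d) x = quot_mult I (h ^ d) y"
      then obtain k l where kl: "k \<in> bihom a b" "x = residue_class I k" "l \<in> bihom a b" "y = residue_class I l"
        by (auto simp: quot_comp_simps)
      have "h ^ d * (k - l) \<in> I"
        using eq kl by (simp add: quot_mult_residue_class residue_class_eq_iff right_diff_distrib)
      from h_power_injective[OF bihom_diff[OF kl(1,3)] this]
      show "x = y" using kl by (simp add: residue_class_eq_iff)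
    qed
    show "residue_class I w \<in> carrier (quot_comp I a b)" using w by (simp add: quot_comp_simps)
    show "quot_mult I (h ^ d) (residue_class I w) = quot_mult I g (residue_class I u)"
      using diff_mem_sym[OF gu] by (simp add: quot_mult_residue_class residue_class_eq_iff)
  qed
  then show ?thesis by (simp add: mult_map_def q)
qed

lemma (in admissible_basis) represents_mult_map_iff:
  assumes q: "fraction_rep h q = (g, d)" and g: "g \<in> bihom d 0"
    and bs: "length bs = N" "\<And>i. i < N \<Longrightarrow> bs ! i = residue_class I (f i)"
  shows "represents (quot_comp I a b) bs (mult_map I a b h q) M \<longleftrightarrow> M = mult_mat d g"
proof -
  have lhs: "mult_map I a b h q (bs ! j) = residue_class I (comb (\<lambda>r. mult_mat d g $$ (r, j)))" if "j < N" for j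
    unfolding bs(2)[OF that]
    by (rule mult_map_residue_class[OF q f_bihom[OF that] comb_bihom mult_mat[OF g that]])
  have rhs: "(\<Oplus>\<^bsub>quot_comp I a b\<^esub>i\<in>{..<N}. M $$ (i, j) \<odot>\<^bsub>quot_comp I a b\<^esub> bs ! i)
      = residue_class I (comb (\<lambda>r. M $$ (r, j)))" for M j
  proof -
    interpret V: vectorspace "class_ring :: 'k ring" "quot_comp I a b" by (rule vs)
    have "(\<Oplus>\<^bsub>quot_comp I a b\<^esub>i\<in>{..<N}. M $$ (i, j) \<odot>\<^bsub>quot_comp I a b\<^esub> bs ! i)
        = (\<Oplus>\<^bsub>quot_comp I a b\<^esub>i\<in>{..<N}. residue_class I (const_poly (M $$ (i, j)) * f i))"
      using f_bihom by (intro V.M.finsum_cong') (auto simp: bs quot_comp_simps intro: bihom_const)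
    also have "\<dots> = residue_class I (comb (\<lambda>r. M $$ (r, j)))"
      unfolding comb_def using f_bihom by (intro finsum_residue_class bihom_const) auto
    finally show ?thesis .
  qed
  have "represents (quot_comp I a b) bs (mult_map I a b h q) M \<longleftrightarrow> M \<in> carrier_mat N N \<and>
      (\<forall>j<N. comb (\<lambda>r. mult_mat d g $$ (r, j)) - comb (\<lambda>r. M $$ (r, j)) \<in> I)"
    unfolding represents_def bs(1) rhs using lhs by (auto simp: residue_class_eq_iff)
  also have "\<dots> \<longleftrightarrow> M = mult_mat d g"
  proof
    assume M: "M \<in> carrier_mat N N \<and>
      (\<forall>j<N. comb (\<lambda>r. mult_mat d g $$ (r, j)) - comb (\<lambda>r. M $$ (r, j)) \<in> I)"
    have "mult_mat d g $$ (r, j) - M $$ (r, j) = 0" if "r < N" "j < N" for r j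
      using M that comb_independent[of "\<lambda>r. mult_mat d g $$ (r, j) - M $$ (r, j)"]
      by (auto simp: comb_diff)
    then show "M = mult_mat d g" using M by (intro eq_matI) auto
  qed auto
  finally show ?thesis .
qed

lemma fraction_rep_bihom:
  assumes "q \<in> localization0 h" "fraction_rep h q = (g, d)"
  shows "g \<in> bihom d 0"
proof -
  have "\<exists>p. case p of (g, d) \<Rightarrow> g \<in> bihom d 0 \<and> q = fraction h g d"
    using assms(1) by (auto simp: localization0_def)
  from someI_ex[OF this] assms(2) show ?thesis by (simp add: fraction_rep_def)
qed

text \<open>Both \<open>g\<close> and \<open>h\<^sup>d\<close> scale by \<open>c\<^sup>d\<close> under a change of homogeneous coordinates, and \<open>h\<close> has value \<open>1\<close> at
  \<open>point j\<close>.\<close>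

lemma (in triangularized_basis) frac_eval_point:
  assumes q: "fraction_rep h q = (g, d)" and g: "g \<in> bihom d 0" and j: "j < N"
  shows "frac_eval h q (proj_point (point j)) = evalX (point j) g"
proof -
  have "(SOME v. v \<in> proj_point (point j)) \<in> proj_point (point j)"
    by (rule someI[of "\<lambda>v. v \<in> proj_point (point j)", OF mem_proj_point])
  then obtain c where c: "c \<noteq> 0" "(SOME v. v \<in> proj_point (point j)) = (\<lambda>i. c * point j i)"
    unfolding proj_point_def by blast
  then show ?thesis
    by (simp add: frac_eval_def q evalX_scale[OF g] evalX_scale[OF h_bihom] point_h[OF j])
qed

text \<open>The multiplicity of a point is the number of diagonal positions at which it occurs.\<close>

lemma (in admissible_bidegree) char_poly_factorization:
  assumes q: "q \<in> localization0 h"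
  shows "finite (proj_pts I b) \<and> (\<exists>\<mu>. (\<forall>\<xi>\<in>proj_pts I b. \<mu> \<xi> > 0) \<and>
    map_poly to_ac (char_poly_endo (quot_comp I a b) (mult_map I a b h q)) =
      (\<Prod>\<xi>\<in>proj_pts I b. [: - frac_eval h q \<xi>, 1 :] ^ \<mu> \<xi>))"
proof -
  obtain g d where gd: "fraction_rep h q = (g, d)" by (cases "fraction_rep h q")
  note g = fraction_rep_bihom[OF q gd]
  let ?V = "quot_comp I a b" and ?T = "mult_map I a b h q"
  let ?is_mat = "\<lambda>M. \<exists>bs. distinct bs \<and> vectorspace.basis class_ring ?V (set bs) \<and> represents ?V bs ?T M"
  have "\<exists>M. ?is_mat M"
  proof -
    obtain bs where bs: "distinct bs" "vectorspace.basis class_ring ?V (set bs)"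
      by (rule basis_list_exists)
    show ?thesis
    proof (rule basis_mod_of_basis[OF bs])
      fix f assume f: "basis_mod a b (length bs) f" "\<And>i. i < length bs \<Longrightarrow> bs ! i = residue_class I (f i)"
      interpret admissible_basis I a b h "length bs" f by unfold_locales (rule f)
      have "represents ?V bs ?T (mult_mat d g)"
        using represents_mult_map_iff[OF gd g refl f(2)] by blast
      then show ?thesis using bs by blast
    qed
  qed
  then have "?is_mat (SOME M. ?is_mat M)" by (rule someI_ex)
  then obtain bs where bs: "distinct bs" "vectorspace.basis class_ring ?V (set bs)"
    and rep: "represents ?V bs ?T (SOME M. ?is_mat M)" by blast
  define N where "N = length bs"
  show ?thesis
  proof (rule basis_mod_of_basis[OF bs])
    fix f assume f: "basis_mod a b (length bs) f" "\<And>i. i < length bs \<Longrightarrow> bs ! i = residue_class I (f i)"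
    interpret admissible_basis I a b h N f by unfold_locales (use f N_def in simp)
    have "(SOME M. ?is_mat M) = mult_mat d g"
      using represents_mult_map_iff[OF gd g, of bs "SOME M. ?is_mat M"] rep f(2) N_def by blast
    then have cp: "char_poly_endo ?V ?T = char_poly (mult_mat d g)"
      unfolding char_poly_endo_def by (rule arg_cong)
    obtain P Q where "triangularized_basis I a b h N f P Q" using triangularization_exists by blast
    then interpret triangularized_basis I a b h N f P Q .
    let ?p = "\<lambda>j. proj_point (point j)"
    let ?\<mu> = "\<lambda>\<xi>. card {j \<in> {..<N}. ?p j = \<xi>}"
    have "map_poly to_ac (char_poly_endo ?V ?T) = (\<Prod>j<N. [: - frac_eval h q (?p j), 1 :])"
      unfolding cp char_poly_mult_mat[OF g] using frac_eval_point[OF gd g] by simp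
    also have "\<dots> = (\<Prod>\<xi>\<in>?p ` {..<N}. \<Prod>j\<in>{j \<in> {..<N}. ?p j = \<xi>}. [: - frac_eval h q (?p j), 1 :])"
      by (rule prod.image_gen) simp
    also have "\<dots> = (\<Prod>\<xi>\<in>proj_pts I b. [: - frac_eval h q \<xi>, 1 :] ^ ?\<mu> \<xi>)"
      unfolding proj_pts_eq by (intro prod.cong) auto
    finally have "map_poly to_ac (char_poly_endo ?V ?T) = (\<Prod>\<xi>\<in>proj_pts I b. [: - frac_eval h q \<xi>, 1 :] ^ ?\<mu> \<xi>)" .
    moreover have "?\<mu> \<xi> > 0" if "\<xi> \<in> proj_pts I b" for \<xi>
      using that unfolding proj_pts_eq by (auto simp: card_gt_0_iff)
    moreover have "finite (proj_pts I b)" unfolding proj_pts_eq by simp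
    ultimately show ?thesis by (intro conjI exI[of _ ?\<mu>]) auto
  qed
qed

theorem theorem3p9:
  fixes I :: "('x::finite, 'y::finite, 'k::field) bipoly set"
    and a b :: nat
    and h :: "('x, 'y, 'k) bipoly"
  assumes "bihomogeneous_ideal I"
    and "admissible I a b"
    and "admissible_form I a b h"
  shows "finite (proj_pts I b) \<and>
    (\<forall>q\<in>localization0 h. \<exists>\<mu> :: ('x, 'k) proj_point \<Rightarrow> nat.
       (\<forall>\<xi>\<in>proj_pts I b. \<mu> \<xi> > 0) \<and>
       map_poly to_ac (char_poly_endo (quot_comp I a b) (mult_map I a b h q)) =
         (\<Prod>\<xi>\<in>proj_pts I b. [: - frac_eval h q \<xi>, 1 :] ^ \<mu> \<xi>))"
proof -
  interpret admissible_bidegree I a b h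
    using assms by unfold_locales (auto simp: admissible_def)
  \<comment> \<open>Finiteness of the set of points is independent of the fraction; the zero fraction provides one.\<close>
  have "fraction h 0 0 \<in> localization0 h" unfolding localization0_def by (intro CollectI exI[of _ 0]) auto
  with char_poly_factorization show ?thesis by blast
qed

end
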